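(* Let $R$ be an associative ring with unit and let $\mathcal X$ be an enveloping class of right $R$-modules such that every right $R$-module has a monomorphic $\mathcal X$-envelope. Let $M$ and $N$ be two $\mathcal X$-endomorphism invariant right $R$-modules, with monomorphic $\mathcal X$-envelopes $v_M:M\rightarrow X(M)$ and $v_N:N\rightarrow X(N)$, respectively. Assume that $N$ is $\mathcal X$-strongly purely closed and that $M$ is an $\mathcal X$-strongly pure submodule of $N$. If there exists an $\mathcal X$-strongly pure monomorphism $u:N\rightarrow M$, then $M\cong N$.
   Context: Modules are unitary right modules over an associative ring $R$ with unit. Let $\mathcal X$ be a class of right $R$-modules closed under isomorphisms and direct summands. An $\mathcal X$-preenvelope of a module $M$ is a homomorphism $u:M\rightarrow X$ with $X\in\mathcal X$ such that any homomorphism $g:M\rightarrow X'$ with $X'\in\mathcal X$ factors through $u$. It is an $\mathcal X$-envelope if, moreover, any endomorphism $h:X\rightarrow X$ with $h\circ u=u$ is an automorphism. An $\mathcal X$-(pre)envelope is monomorphic if it is a monomorphism. The class $\mathcal X$ (closed under isomorphisms and direct summands) is an enveloping class if every right $R$-module has an $\mathcal X$-envelope. A module $M$ with monomorphic $\mathcal X$-envelope $v_M:M\rightarrow X(M)$ is $\mathcal X$-endomorphism invariant if for every endomorphism $\varphi:X(M)\rightarrow X(M)$ there exists an endomorphism $f:M\rightarrow M$ such that $v_M\circ f=\varphi\circ v_M$. A homomorphism $u:N\rightarrow M$ is an $\mathcal X$-strongly pure monomorphism if every homomorphism $f:N\rightarrow X$ with $X\in\mathcal X$ extends to a homomorphism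 $g:M\rightarrow X$ with $g\circ u=f$ (such a $u$ is automatically injective when every module has a monomorphic $\mathcal X$-envelope). A submodule $N$ of $M$ is an $\mathcal X$-strongly pure submodule if the inclusion $N\rightarrow M$ is an $\mathcal X$-strongly pure monomorphism. $\mathrm{add}[M]$ denotes the class of all direct summands of finite direct sums of copies of $M$. A module $M$ is $\mathcal X$-strongly purely closed if any direct limit of splitting monomorphisms among objects in $\mathrm{add}[M]$ is an $\mathcal X$-strongly pure monomorphism; that is, if $(u_i:A_i\rightarrow B_i)_{i\in I}$ is a morphism of direct systems over a directed set $I$ with all $A_i,B_i\in\mathrm{add}[M]$ and every $u_i$ a split monomorphism, then $\varinjlim u_i:\varinjlim A_i\rightarrow\varinjlim B_i$ is an $\mathcal X$-strongly pure monomorphism. *)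

theory Defs
  imports "HOL-Algebra.Module" "HOL-Algebra.AbelCoset" "HOL-Library.Equipollence"
begin

section \<open>Right modules\<close>

text \<open>
  The record type of \<^theory>\<open>HOL-Algebra.Module\<close> is reused, but its locale is not, because that one
  requires a commutative ring. The term \<open>a \<odot>\<^bsub>M\<^esub> x\<close> is read as the right action \<open>x a\<close>, whence the
  order of the factors in \<open>smult_assoc\<close>. The fields \<open>mult\<close> and \<open>one\<close> of a module are irrelevant.
\<close>

locale right_module = R?: ring R + M?: abelian_group M
  for R :: "('r, 'a) ring_scheme" (structure) and M :: "('r, 'm) module" (structure) +
  assumes smult_closed:
      "\<lbrakk>a \<in> carrier R; x \<in> carrier M\<rbrakk> \<Longrightarrow> a \<odot>\<^bsub>M\<^esub> x \<in> carrier M"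
    and smult_distr_ring:
      "\<lbrakk>a \<in> carrier R; b \<in> carrier R; x \<in> carrier M\<rbrakk> \<Longrightarrow>
        (a \<oplus>\<^bsub>R\<^esub> b) \<odot>\<^bsub>M\<^esub> x = a \<odot>\<^bsub>M\<^esub> x \<oplus>\<^bsub>M\<^esub> b \<odot>\<^bsub>M\<^esub> x"
    and smult_distr_module:
      "\<lbrakk>a \<in> carrier R; x \<in> carrier M; y \<in> carrier M\<rbrakk> \<Longrightarrow>
        a \<odot>\<^bsub>M\<^esub> (x \<oplus>\<^bsub>M\<^esub> y) = a \<odot>\<^bsub>M\<^esub> x \<oplus>\<^bsub>M\<^esub> a \<odot>\<^bsub>M\<^esub> y"
    and smult_assoc:
      "\<lbrakk>a \<in> carrier R; b \<in> carrier R; x \<in> carrier M\<rbrakk> \<Longrightarrow>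
        (a \<otimes>\<^bsub>R\<^esub> b) \<odot>\<^bsub>M\<^esub> x = b \<odot>\<^bsub>M\<^esub> (a \<odot>\<^bsub>M\<^esub> x)"
    and smult_one:
      "x \<in> carrier M \<Longrightarrow> \<one>\<^bsub>R\<^esub> \<odot>\<^bsub>M\<^esub> x = x"

text \<open>
  The type \<open>'m\<close> plays the role of a set-theoretic universe: a set counts as small if its
  cardinality is less than that of \<open>'m\<close>, and the modules with small carrier in \<open>'m\<close>,
  collected in \<open>right_modules R\<close>, stand for the class of all right \<open>R\<close>-modules. Nothing is
  assumed about \<open>'m\<close>; it may be taken as large and as closed under set-theoretic constructions
  as desired.
\<close>

definition right_modules :: "('r, 'a) ring_scheme \<Rightarrow> ('r, 'm) module set" where
  "right_modules R = {M. right_module R M \<and> carrier M \<prec> (UNIV :: 'm set)}"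

text \<open>
  A homomorphism is determined by its values on the carrier of its domain, so equalities of
  homomorphisms are always stated pointwise on carriers.
\<close>

definition rmod_hom ::
  "('r, 'a) ring_scheme \<Rightarrow> ('r, 'm) module \<Rightarrow> ('r, 'n) module \<Rightarrow> ('m \<Rightarrow> 'n) set" where
  "rmod_hom R M N = {f \<in> carrier M \<rightarrow> carrier N.
     (\<forall>x\<in>carrier M. \<forall>y\<in>carrier M. f (x \<oplus>\<^bsub>M\<^esub> y) = f x \<oplus>\<^bsub>N\<^esub> f y) \<and>
     (\<forall>a\<in>carrier R. \<forall>x\<in>carrier M. f (a \<odot>\<^bsub>M\<^esub> x) = a \<odot>\<^bsub>N\<^esub> f x)}"

definition rmod_iso ::
  "('r, 'a) ring_scheme \<Rightarrow> ('r, 'm) module \<Rightarrow> ('r, 'n) module \<Rightarrow> ('m \<Rightarrow> 'n) set" where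
  "rmod_iso R M N = {f \<in> rmod_hom R M N. bij_betw f (carrier M) (carrier N)}"

definition rmod_isomorphic ::
  "('r, 'a) ring_scheme \<Rightarrow> ('r, 'm) module \<Rightarrow> ('r, 'n) module \<Rightarrow> bool" where
  "rmod_isomorphic R M N \<longleftrightarrow> rmod_iso R M N \<noteq> {}"

definition split_mono ::
  "('r, 'a) ring_scheme \<Rightarrow> ('r, 'm) module \<Rightarrow> ('r, 'n) module \<Rightarrow> ('m \<Rightarrow> 'n) \<Rightarrow> bool" where
  "split_mono R M N u \<longleftrightarrow> u \<in> rmod_hom R M N \<and>
     (\<exists>p\<in>rmod_hom R N M. \<forall>x\<in>carrier M. p (u x) = x)"

text \<open>
  Submodules are themselves module records; that the inclusion is a homomorphism says that the
  operations of the submodule are the restricted ones.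
\<close>

definition is_submodule ::
  "('r, 'a) ring_scheme \<Rightarrow> ('r, 'm) module \<Rightarrow> ('r, 'm) module \<Rightarrow> bool" where
  "is_submodule R A M \<longleftrightarrow> right_module R A \<and> right_module R M \<and>
     carrier A \<subseteq> carrier M \<and> (\<lambda>x. x) \<in> rmod_hom R A M"

definition direct_summand ::
  "('r, 'a) ring_scheme \<Rightarrow> ('r, 'm) module \<Rightarrow> ('r, 'm) module \<Rightarrow> bool" where
  "direct_summand R A M \<longleftrightarrow> is_submodule R A M \<and>
     (\<exists>B. is_submodule R B M \<and> carrier A \<inter> carrier B = {\<zero>\<^bsub>M\<^esub>} \<and>
          carrier A <+>\<^bsub>M\<^esub> carrier B = carrier M)"


section \<open>Envelopes\<close>

definition preenvelope ::
  "('r, 'a) ring_scheme \<Rightarrow> ('r, 'm) module set \<Rightarrow> ('r, 'n) module \<Rightarrow>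
    ('r, 'm) module \<Rightarrow> ('n \<Rightarrow> 'm) \<Rightarrow> bool" where
  "preenvelope R \<C> M X u \<longleftrightarrow> X \<in> \<C> \<and> u \<in> rmod_hom R M X \<and>
     (\<forall>X'\<in>\<C>. \<forall>g\<in>rmod_hom R M X'. \<exists>h\<in>rmod_hom R X X'. \<forall>x\<in>carrier M. h (u x) = g x)"

definition envelope ::
  "('r, 'a) ring_scheme \<Rightarrow> ('r, 'm) module set \<Rightarrow> ('r, 'n) module \<Rightarrow>
    ('r, 'm) module \<Rightarrow> ('n \<Rightarrow> 'm) \<Rightarrow> bool" where
  "envelope R \<C> M X u \<longleftrightarrow> preenvelope R \<C> M X u \<and>
     (\<forall>h\<in>rmod_hom R X X. (\<forall>x\<in>carrier M. h (u x) = u x) \<longrightarrow> h \<in> rmod_iso R X X)"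

definition mono_envelope ::
  "('r, 'a) ring_scheme \<Rightarrow> ('r, 'm) module set \<Rightarrow> ('r, 'n) module \<Rightarrow>
    ('r, 'm) module \<Rightarrow> ('n \<Rightarrow> 'm) \<Rightarrow> bool" where
  "mono_envelope R \<C> M X u \<longleftrightarrow> envelope R \<C> M X u \<and> inj_on u (carrier M)"

definition enveloping_class :: "('r, 'a) ring_scheme \<Rightarrow> ('r, 'm) module set \<Rightarrow> bool" where
  "enveloping_class R \<C> \<longleftrightarrow> \<C> \<subseteq> right_modules R \<and>
     (\<forall>X\<in>\<C>. \<forall>Y\<in>right_modules R. rmod_isomorphic R X Y \<longrightarrow> Y \<in> \<C>) \<and>
     (\<forall>X\<in>\<C>. \<forall>A. direct_summand R A X \<longrightarrow> A \<in> \<C>) \<and>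
     (\<forall>M\<in>(right_modules R :: ('r, 'm) module set). \<exists>X u. envelope R \<C> M X u)"

definition endomorphism_invariant ::
  "('r, 'a) ring_scheme \<Rightarrow> ('r, 'm) module set \<Rightarrow> ('r, 'n) module \<Rightarrow>
    ('r, 'm) module \<Rightarrow> ('n \<Rightarrow> 'm) \<Rightarrow> bool" where
  "endomorphism_invariant R \<C> M X v \<longleftrightarrow> mono_envelope R \<C> M X v \<and>
     (\<forall>\<phi>\<in>rmod_hom R X X. \<exists>f\<in>rmod_hom R M M. \<forall>x\<in>carrier M. v (f x) = \<phi> (v x))"


section \<open>Strongly pure monomorphisms\<close>

definition strongly_pure_mono ::
  "('r, 'a) ring_scheme \<Rightarrow> ('r, 'm) module set \<Rightarrow> ('r, 'n) module \<Rightarrow>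
    ('r, 'k) module \<Rightarrow> ('n \<Rightarrow> 'k) \<Rightarrow> bool" where
  "strongly_pure_mono R \<C> N M u \<longleftrightarrow> u \<in> rmod_hom R N M \<and>
     (\<forall>X\<in>\<C>. \<forall>f\<in>rmod_hom R N X. \<exists>g\<in>rmod_hom R M X. \<forall>x\<in>carrier N. g (u x) = f x)"

definition strongly_pure_submodule ::
  "('r, 'a) ring_scheme \<Rightarrow> ('r, 'm) module set \<Rightarrow> ('r, 'n) module \<Rightarrow> ('r, 'n) module \<Rightarrow> bool" where
  "strongly_pure_submodule R \<C> N M \<longleftrightarrow>
     is_submodule R N M \<and> strongly_pure_mono R \<C> N M (\<lambda>x. x)"


section \<open>Finite direct sums of copies of a module\<close>

definition rmod_power :: "('r, 'm) module \<Rightarrow> nat \<Rightarrow> ('r, nat \<Rightarrow> 'm) module" where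
  "rmod_power M n =
    \<lparr>carrier = {..<n} \<rightarrow>\<^sub>E carrier M,
     monoid.mult = undefined,
     one = undefined,
     zero = (\<lambda>i\<in>{..<n}. \<zero>\<^bsub>M\<^esub>),
     add = (\<lambda>f g. \<lambda>i\<in>{..<n}. f i \<oplus>\<^bsub>M\<^esub> g i),
     smult = (\<lambda>a f. \<lambda>i\<in>{..<n}. a \<odot>\<^bsub>M\<^esub> f i)\<rparr>"

text \<open>As usual, \<open>add[M]\<close> is understood to be closed under isomorphism.\<close>

definition add_class :: "('r, 'a) ring_scheme \<Rightarrow> ('r, 'm) module \<Rightarrow> ('r, 'm) module set" where
  "add_class R M = {A \<in> right_modules R.
     \<exists>n D. direct_summand R D (rmod_power M n) \<and> rmod_isomorphic R A D}"


section \<open>Direct limits\<close>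

definition directed_set :: "'i set \<Rightarrow> ('i \<Rightarrow> 'i \<Rightarrow> bool) \<Rightarrow> bool" where
  "directed_set I r \<longleftrightarrow> I \<noteq> {} \<and> (\<forall>i\<in>I. r i i) \<and>
     (\<forall>i\<in>I. \<forall>j\<in>I. \<forall>k\<in>I. r i j \<longrightarrow> r j k \<longrightarrow> r i k) \<and>
     (\<forall>i\<in>I. \<forall>j\<in>I. \<exists>k\<in>I. r i k \<and> r j k)"

definition direct_system ::
  "('r, 'a) ring_scheme \<Rightarrow> 'i set \<Rightarrow> ('i \<Rightarrow> 'i \<Rightarrow> bool) \<Rightarrow>
    ('i \<Rightarrow> ('r, 'm) module) \<Rightarrow> ('i \<Rightarrow> 'i \<Rightarrow> 'm \<Rightarrow> 'm) \<Rightarrow> bool" where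
  "direct_system R I r A f \<longleftrightarrow> directed_set I r \<and> (\<forall>i\<in>I. A i \<in> right_modules R) \<and>
     (\<forall>i\<in>I. \<forall>j\<in>I. r i j \<longrightarrow> f i j \<in> rmod_hom R (A i) (A j)) \<and>
     (\<forall>i\<in>I. \<forall>x\<in>carrier (A i). f i i x = x) \<and>
     (\<forall>i\<in>I. \<forall>j\<in>I. \<forall>k\<in>I. r i j \<longrightarrow> r j k \<longrightarrow>
        (\<forall>x\<in>carrier (A i). f j k (f i j x) = f i k x))"

definition cocone ::
  "('r, 'a) ring_scheme \<Rightarrow> 'i set \<Rightarrow> ('i \<Rightarrow> 'i \<Rightarrow> bool) \<Rightarrow>
    ('i \<Rightarrow> ('r, 'm) module) \<Rightarrow> ('i \<Rightarrow> 'i \<Rightarrow> 'm \<Rightarrow> 'm) \<Rightarrow>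
    ('r, 'm) module \<Rightarrow> ('i \<Rightarrow> 'm \<Rightarrow> 'm) \<Rightarrow> bool" where
  "cocone R I r A f L \<alpha> \<longleftrightarrow> L \<in> right_modules R \<and>
     (\<forall>i\<in>I. \<alpha> i \<in> rmod_hom R (A i) L) \<and>
     (\<forall>i\<in>I. \<forall>j\<in>I. r i j \<longrightarrow> (\<forall>x\<in>carrier (A i). \<alpha> j (f i j x) = \<alpha> i x))"

definition direct_limit ::
  "('r, 'a) ring_scheme \<Rightarrow> 'i set \<Rightarrow> ('i \<Rightarrow> 'i \<Rightarrow> bool) \<Rightarrow>
    ('i \<Rightarrow> ('r, 'm) module) \<Rightarrow> ('i \<Rightarrow> 'i \<Rightarrow> 'm \<Rightarrow> 'm) \<Rightarrow>
    ('r, 'm) module \<Rightarrow> ('i \<Rightarrow> 'm \<Rightarrow> 'm) \<Rightarrow> bool" where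
  "direct_limit R I r A f L \<alpha> \<longleftrightarrow> cocone R I r A f L \<alpha> \<and>
     (\<forall>P \<beta>. cocone R I r A f P \<beta> \<longrightarrow>
       (\<exists>h\<in>rmod_hom R L P. \<forall>i\<in>I. \<forall>x\<in>carrier (A i). h (\<alpha> i x) = \<beta> i x) \<and>
       (\<forall>h\<in>rmod_hom R L P. \<forall>h'\<in>rmod_hom R L P.
          (\<forall>i\<in>I. \<forall>x\<in>carrier (A i). h (\<alpha> i x) = \<beta> i x) \<longrightarrow>
          (\<forall>i\<in>I. \<forall>x\<in>carrier (A i). h' (\<alpha> i x) = \<beta> i x) \<longrightarrow>
          (\<forall>y\<in>carrier L. h y = h' y)))"

definition direct_system_morphism ::
  "('r, 'a) ring_scheme \<Rightarrow> 'i set \<Rightarrow> ('i \<Rightarrow> 'i \<Rightarrow> bool) \<Rightarrow>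
    ('i \<Rightarrow> ('r, 'm) module) \<Rightarrow> ('i \<Rightarrow> 'i \<Rightarrow> 'm \<Rightarrow> 'm) \<Rightarrow>
    ('i \<Rightarrow> ('r, 'm) module) \<Rightarrow> ('i \<Rightarrow> 'i \<Rightarrow> 'm \<Rightarrow> 'm) \<Rightarrow>
    ('i \<Rightarrow> 'm \<Rightarrow> 'm) \<Rightarrow> bool" where
  "direct_system_morphism R I r A f B g u \<longleftrightarrow>
     (\<forall>i\<in>I. u i \<in> rmod_hom R (A i) (B i)) \<and>
     (\<forall>i\<in>I. \<forall>j\<in>I. r i j \<longrightarrow> (\<forall>x\<in>carrier (A i). u j (f i j x) = g i j (u i x)))"

text \<open>
  Below, \<open>w\<close> is the direct limit of the \<open>u i\<close>, being the homomorphism that commutes with the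
  cocones. Index sets are arbitrary small sets of the universe \<open>'m\<close>.
\<close>

definition strongly_purely_closed ::
  "('r, 'a) ring_scheme \<Rightarrow> ('r, 'm) module set \<Rightarrow> ('r, 'm) module \<Rightarrow> bool" where
  "strongly_purely_closed R \<C> M \<longleftrightarrow>
     (\<forall>(I :: 'm set) r A f B g u L \<alpha> L' \<beta> w.
        I \<prec> (UNIV :: 'm set) \<longrightarrow>
        direct_system R I r A f \<longrightarrow> direct_system R I r B g \<longrightarrow>
        (\<forall>i\<in>I. A i \<in> add_class R M \<and> B i \<in> add_class R M) \<longrightarrow>
        direct_system_morphism R I r A f B g u \<longrightarrow>
        (\<forall>i\<in>I. split_mono R (A i) (B i) (u i)) \<longrightarrow>
        direct_limit R I r A f L \<alpha> \<longrightarrow> direct_limit R I r B g L' \<beta> \<longrightarrow>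
        w \<in> rmod_hom R L L' \<longrightarrow>
        (\<forall>i\<in>I. \<forall>x\<in>carrier (A i). w (\<alpha> i x) = \<beta> i (u i x)) \<longrightarrow>
        strongly_pure_mono R \<C> L L' w)"

end

theory Submission
  imports Defs
begin

text \<open>
  Splittings between \<open>X(M)\<close> and \<open>X(N)\<close> descend along endomorphism invariance: \<open>M\<close> is the image of an
  idempotent endomorphism \<open>e\<close> of \<open>N\<close>, and \<open>u\<close> has a retraction \<open>p\<close> that kills \<open>K = (1 - e) N\<close>.
  As in Bumby's argument, consider \<open>P = K \<oplus> u K \<oplus> u\<^sup>2 K \<oplus> \<dots>\<close>. It is the directed union of summands of
  \<open>N\<close>, hence strongly pure in \<open>N\<close>, and \<open>P = K \<oplus> u P\<close>. Since \<open>X(P)\<close> is a summand of \<open>X(N)\<close>, there is an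
  idempotent endomorphism \<open>q\<close> of \<open>N\<close>, the identity on \<open>P\<close>, such that an endomorphism of \<open>N\<close> that
  fixes \<open>P\<close> pointwise and induces the identity modulo \<open>q N\<close> is bijective. With
  \<open>U = 1 - q + q u\<close> and \<open>V = 1 - q + q p\<close> this applies to \<open>V e U\<close> and to \<open>e U V + (1 - e)\<close>, so \<open>e U\<close> maps \<open>N\<close>
  isomorphically onto \<open>e N = M\<close>. The purity of \<open>P\<close> needs an infinite index set in the universe;
  if \<open>N\<close> is finite, \<open>M = N\<close> by counting.
\<close>

section \<open>Homomorphisms of right modules\<close>

lemma rmod_homI:
  assumes "\<And>x. x \<in> carrier A \<Longrightarrow> f x \<in> carrier B"
    and "\<And>x y. \<lbrakk>x \<in> carrier A; y \<in> carrier A\<rbrakk> \<Longrightarrow> f (x \<oplus>\<^bsub>A\<^esub> y) = f x \<oplus>\<^bsub>B\<^esub> f y"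
    and "\<And>a x. \<lbrakk>a \<in> carrier R; x \<in> carrier A\<rbrakk> \<Longrightarrow> f (a \<odot>\<^bsub>A\<^esub> x) = a \<odot>\<^bsub>B\<^esub> f x"
  shows "f \<in> rmod_hom R A B"
  using assms by (auto simp: rmod_hom_def)

lemma rmod_hom_closed: "\<lbrakk>f \<in> rmod_hom R A B; x \<in> carrier A\<rbrakk> \<Longrightarrow> f x \<in> carrier B"
  by (auto simp: rmod_hom_def)

lemma rmod_hom_add:
  "\<lbrakk>f \<in> rmod_hom R A B; x \<in> carrier A; y \<in> carrier A\<rbrakk> \<Longrightarrow> f (x \<oplus>\<^bsub>A\<^esub> y) = f x \<oplus>\<^bsub>B\<^esub> f y"
  by (auto simp: rmod_hom_def)

lemma rmod_hom_smult:
  "\<lbrakk>f \<in> rmod_hom R A B; a \<in> carrier R; x \<in> carrier A\<rbrakk> \<Longrightarrow> f (a \<odot>\<^bsub>A\<^esub> x) = a \<odot>\<^bsub>B\<^esub> f x"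
  by (auto simp: rmod_hom_def)

lemma rmod_hom_id: "(\<lambda>x. x) \<in> rmod_hom R A A"
  by (auto simp: rmod_hom_def)

lemma rmod_hom_compose:
  assumes "g \<in> rmod_hom R B C" "f \<in> rmod_hom R A B"
  shows "(\<lambda>x. g (f x)) \<in> rmod_hom R A C"
  using assms by (auto simp: rmod_hom_def Pi_iff)

text \<open>Zero is not part of the definition of a homomorphism; it follows by cancelling in
  \<open>f 0 + f 0 = f 0\<close>.\<close>

lemma rmod_hom_zero:
  assumes f: "f \<in> rmod_hom R A B" and "right_module R A" "right_module R B"
  shows "f \<zero>\<^bsub>A\<^esub> = \<zero>\<^bsub>B\<^esub>"
proof -
  interpret A: right_module R A by fact
  interpret B: right_module R B by fact
  have c: "f \<zero>\<^bsub>A\<^esub> \<in> carrier B" using f by (rule rmod_hom_closed) simp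
  have "f \<zero>\<^bsub>A\<^esub> \<oplus>\<^bsub>B\<^esub> f \<zero>\<^bsub>A\<^esub> = f (\<zero>\<^bsub>A\<^esub> \<oplus>\<^bsub>A\<^esub> \<zero>\<^bsub>A\<^esub>)"
    using rmod_hom_add[OF f] A.M.zero_closed by metis
  then have "f \<zero>\<^bsub>A\<^esub> \<oplus>\<^bsub>B\<^esub> f \<zero>\<^bsub>A\<^esub> = f \<zero>\<^bsub>A\<^esub>" by simp
  with c show ?thesis by (metis B.M.add.l_cancel_one B.M.zero_closed)
qed

lemma rmod_hom_a_inv:
  assumes f: "f \<in> rmod_hom R A B" and A: "right_module R A" and B: "right_module R B"
    and x: "x \<in> carrier A"
  shows "f (\<ominus>\<^bsub>A\<^esub> x) = \<ominus>\<^bsub>B\<^esub> f x"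
proof -
  interpret A: right_module R A by fact
  interpret B: right_module R B by fact
  have "f (\<ominus>\<^bsub>A\<^esub> x) \<oplus>\<^bsub>B\<^esub> f x = f (\<ominus>\<^bsub>A\<^esub> x \<oplus>\<^bsub>A\<^esub> x)"
    using rmod_hom_add[OF f] x by simp
  also have "\<dots> = \<zero>\<^bsub>B\<^esub>" using x rmod_hom_zero[OF f A B] by (simp add: A.M.l_neg)
  finally show ?thesis
    using rmod_hom_closed[OF f] x by (metis A.M.a_inv_closed B.M.minus_equality)
qed

lemma rmod_hom_minus:
  assumes f: "f \<in> rmod_hom R A B" and A: "right_module R A" and B: "right_module R B"
    and "x \<in> carrier A" "y \<in> carrier A"
  shows "f (x \<ominus>\<^bsub>A\<^esub> y) = f x \<ominus>\<^bsub>B\<^esub> f y"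
proof -
  interpret A: right_module R A by fact
  show ?thesis
    using assms by (simp add: a_minus_def rmod_hom_add[OF f] rmod_hom_a_inv[OF f A B])
qed

lemma (in right_module) smult_a_inv:
  assumes "a \<in> carrier R" "x \<in> carrier M"
  shows "a \<odot>\<^bsub>M\<^esub> (\<ominus>\<^bsub>M\<^esub> x) = \<ominus>\<^bsub>M\<^esub> (a \<odot>\<^bsub>M\<^esub> x)"
proof -
  have z: "a \<odot>\<^bsub>M\<^esub> \<zero>\<^bsub>M\<^esub> = \<zero>\<^bsub>M\<^esub>"
    by (metis M.add.l_cancel_one M.r_zero M.zero_closed assms(1) smult_closed smult_distr_module)
  have "a \<odot>\<^bsub>M\<^esub> (\<ominus>\<^bsub>M\<^esub> x) \<oplus>\<^bsub>M\<^esub> a \<odot>\<^bsub>M\<^esub> x = \<zero>\<^bsub>M\<^esub>"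
    using assms z by (simp flip: smult_distr_module add: M.l_neg)
  then show ?thesis
    using assms by (metis M.a_inv_closed M.minus_equality smult_closed)
qed

lemma rmod_hom_sum:
  assumes B: "right_module R B" and f: "f \<in> rmod_hom R A B" and g: "g \<in> rmod_hom R A B"
  shows "(\<lambda>x. f x \<oplus>\<^bsub>B\<^esub> g x) \<in> rmod_hom R A B"
proof -
  interpret B: right_module R B by fact
  show ?thesis
    by (rule rmod_homI)
      (auto simp: rmod_hom_closed[OF f] rmod_hom_closed[OF g] rmod_hom_add[OF f] rmod_hom_add[OF g]
        rmod_hom_smult[OF f] rmod_hom_smult[OF g] B.smult_distr_module B.M.a_ac)
qed

lemma rmod_hom_diff:
  assumes B: "right_module R B" and f: "f \<in> rmod_hom R A B" and g: "g \<in> rmod_hom R A B"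
  shows "(\<lambda>x. f x \<ominus>\<^bsub>B\<^esub> g x) \<in> rmod_hom R A B"
proof -
  interpret B: right_module R B by fact
  have "(\<lambda>x. \<ominus>\<^bsub>B\<^esub> g x) \<in> rmod_hom R A B"
    by (rule rmod_homI)
      (auto simp: rmod_hom_closed[OF g] rmod_hom_add[OF g] rmod_hom_smult[OF g]
        B.smult_a_inv B.M.minus_add)
  from rmod_hom_sum[OF B f this] show ?thesis by (simp add: a_minus_def)
qed

lemma rmod_hom_const_zero:
  assumes B: "right_module R B"
  shows "(\<lambda>x. \<zero>\<^bsub>B\<^esub>) \<in> rmod_hom R A B"
proof -
  interpret B: right_module R B by fact
  show ?thesis
    by (rule rmod_homI)
      (auto, metis B.M.add.l_cancel_one B.M.r_zero B.M.zero_closed B.smult_closed B.smult_distr_module)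
qed

lemma rmod_iso_inv:
  assumes f: "f \<in> rmod_iso R A B" and A: "right_module R A"
  shows "inv_into (carrier A) f \<in> rmod_iso R B A"
proof -
  interpret A: right_module R A by fact
  let ?g = "inv_into (carrier A) f"
  have h: "f \<in> rmod_hom R A B" and b: "bij_betw f (carrier A) (carrier B)"
    using f by (auto simp: rmod_iso_def)
  have gc: "?g y \<in> carrier A" and fg: "f (?g y) = y" if "y \<in> carrier B" for y
    using b that by (auto simp: bij_betw_def inv_into_into f_inv_into_f)
  have gf: "?g (f x) = x" if "x \<in> carrier A" for x
    using b that by (auto simp: bij_betw_def)
  have "?g \<in> rmod_hom R B A"
  proof (rule rmod_homI)
    fix x y assume x: "x \<in> carrier B" and y: "y \<in> carrier B"
    have "?g (f (?g x \<oplus>\<^bsub>A\<^esub> ?g y)) = ?g x \<oplus>\<^bsub>A\<^esub> ?g y" using gc x y gf by simp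
    then show "?g (x \<oplus>\<^bsub>B\<^esub> y) = ?g x \<oplus>\<^bsub>A\<^esub> ?g y"
      using x y gc fg by (simp add: rmod_hom_add[OF h])
  next
    fix a x assume a: "a \<in> carrier R" and x: "x \<in> carrier B"
    have "?g (f (a \<odot>\<^bsub>A\<^esub> ?g x)) = a \<odot>\<^bsub>A\<^esub> ?g x" using gc x a gf A.smult_closed by simp
    then show "?g (a \<odot>\<^bsub>B\<^esub> x) = a \<odot>\<^bsub>A\<^esub> ?g x"
      using x a gc fg by (simp add: rmod_hom_smult[OF h])
  qed (rule gc)
  then show ?thesis using b by (simp add: rmod_iso_def bij_betw_inv_into)
qed

lemma rmod_iso_inverse:
  assumes f: "f \<in> rmod_iso R A B" and A: "right_module R A"
  obtains g where "g \<in> rmod_hom R B A" "\<And>x. x \<in> carrier A \<Longrightarrow> g (f x) = x"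
    "\<And>y. y \<in> carrier B \<Longrightarrow> f (g y) = y"
proof
  have b: "bij_betw f (carrier A) (carrier B)" using f by (simp add: rmod_iso_def)
  let ?g = "inv_into (carrier A) f"
  show "?g \<in> rmod_hom R B A" using rmod_iso_inv[OF f A] by (simp add: rmod_iso_def)
  show "?g (f x) = x" if "x \<in> carrier A" for x by (rule bij_betw_inv_into_left[OF b that])
  show "f (?g y) = y" if "y \<in> carrier B" for y by (rule bij_betw_inv_into_right[OF b that])
qed

section \<open>Differences in abelian groups\<close>

lemma (in abelian_group) minus_eq_zero_iff:
  assumes "a \<in> carrier G" "b \<in> carrier G"
  shows "a \<ominus> b = \<zero> \<longleftrightarrow> a = b"
  using assms by (metis a_inv_closed minus_eq minus_equality minus_minus r_neg)

text \<open>Serves the surjectivity argument for hulls: from \<open>y - q y = h y - q (h y)\<close>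
  it yields \<open>y - h y = q y - q (h y)\<close>, which places \<open>y - h y\<close> in the image
  of \<open>q\<close>.\<close>

lemma (in abelian_group) minus_swap_inner:
  assumes "a \<ominus> b = c \<ominus> d" "a \<in> carrier G" "b \<in> carrier G" "c \<in> carrier G" "d \<in> carrier G"
  shows "a \<ominus> c = b \<ominus> d"
proof -
  have "a = a \<ominus> b \<oplus> b" using assms(2-) by (simp add: a_minus_def a_assoc l_neg)
  also have "\<dots> = c \<ominus> d \<oplus> b" by (simp only: assms(1))
  finally have "a \<ominus> c = (c \<ominus> d \<oplus> b) \<ominus> c" by simp
  also have "\<dots> = b \<ominus> d" using assms(2-) by (simp add: a_minus_def a_ac r_neg r_neg1 r_neg2)
  finally show ?thesis .
qed


section \<open>Submodules and direct summands\<close>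

text \<open>The submodules of \<open>N\<close> constructed later all have this shape. Only the
  carrier shrinks and the operations stay, so the inclusion is literally the identity
  function.\<close>

lemma right_module_restrict:
  assumes M: "right_module R M" and S: "S \<subseteq> carrier M" "\<zero>\<^bsub>M\<^esub> \<in> S"
    and add: "\<And>x y. \<lbrakk>x \<in> S; y \<in> S\<rbrakk> \<Longrightarrow> x \<oplus>\<^bsub>M\<^esub> y \<in> S"
    and neg: "\<And>x. x \<in> S \<Longrightarrow> \<ominus>\<^bsub>M\<^esub> x \<in> S"
    and smult: "\<And>a x. \<lbrakk>a \<in> carrier R; x \<in> S\<rbrakk> \<Longrightarrow> a \<odot>\<^bsub>M\<^esub> x \<in> S"
  shows "right_module R (M\<lparr>carrier := S\<rparr>)"
proof -
  interpret M: right_module R M by fact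
  have mem: "x \<in> carrier M" if "x \<in> S" for x using that S by auto
  have "abelian_group (M\<lparr>carrier := S\<rparr>)"
  proof (rule abelian_groupI)
    fix x assume "x \<in> carrier (M\<lparr>carrier := S\<rparr>)"
    then show "\<exists>y\<in>carrier (M\<lparr>carrier := S\<rparr>).
        y \<oplus>\<^bsub>M\<lparr>carrier := S\<rparr>\<^esub> x = \<zero>\<^bsub>M\<lparr>carrier := S\<rparr>\<^esub>"
      using neg mem by (auto intro!: bexI[of _ "\<ominus>\<^bsub>M\<^esub> x"] simp: M.M.l_neg)
  qed (use S add mem in \<open>auto simp: M.M.a_ac\<close>)
  then show ?thesis
    by (intro right_module.intro right_module_axioms.intro)
      (use mem smult in \<open>auto simp: M.smult_distr_ring M.smult_distr_module M.smult_assoc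
        M.smult_one M.R.ring_axioms\<close>)
qed

lemma is_submodule_restrict:
  assumes "right_module R M" "right_module R (M\<lparr>carrier := S\<rparr>)" "S \<subseteq> carrier M"
  shows "is_submodule R (M\<lparr>carrier := S\<rparr>) M"
  using assms by (auto simp: is_submodule_def rmod_hom_def)

text \<open>For an idempotent \<open>f\<close> this carrier is the image of \<open>f\<close>.
  Describing it by the equation \<open>f x = x\<close> makes closure under the operations a
  consequence of linearity.\<close>

lemma right_module_fixed_points:
  assumes M: "right_module R M" and f: "f \<in> rmod_hom R M M"
  shows "right_module R (M\<lparr>carrier := {x \<in> carrier M. f x = x}\<rparr>)"
proof -
  interpret M: right_module R M by fact
  show ?thesis
    by (rule right_module_restrict[OF M])
      (auto simp: rmod_hom_zero[OF f M M] rmod_hom_add[OF f] rmod_hom_a_inv[OF f M M]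
        rmod_hom_smult[OF f] M.smult_closed)
qed

text \<open>The complement is the kernel of \<open>f\<close>. It is presented as the set of fixed
  points of \<open>1 - f\<close>, so that the preceding lemma makes it a module too; every
  \<open>x\<close> splits as \<open>f x + (x - f x)\<close>.\<close>

lemma direct_summand_fixed_points:
  assumes M: "right_module R M" and f: "f \<in> rmod_hom R M M"
    and idem: "\<And>x. x \<in> carrier M \<Longrightarrow> f (f x) = f x"
  shows "direct_summand R (M\<lparr>carrier := {x \<in> carrier M. f x = x}\<rparr>) M"
proof -
  interpret M: right_module R M by fact
  let ?k = "\<lambda>x. x \<ominus>\<^bsub>M\<^esub> f x"
  let ?A = "{x \<in> carrier M. f x = x}" and ?B = "{x \<in> carrier M. ?k x = x}"
  note fc = rmod_hom_closed[OF f]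
  have k: "?k \<in> rmod_hom R M M" by (intro rmod_hom_diff M rmod_hom_id f)
  have ker: "?k x = x \<longleftrightarrow> f x = \<zero>\<^bsub>M\<^esub>" if x: "x \<in> carrier M" for x
    using x fc[OF x] M.M.add.l_cancel_one[of x "\<ominus>\<^bsub>M\<^esub> f x"]
    by (metis M.M.minus_eq M.M.a_inv_closed M.M.minus_minus M.M.r_neg M.M.l_zero)
  have dec: "x = f x \<oplus>\<^bsub>M\<^esub> ?k x" if "x \<in> carrier M" for x
    using that fc[OF that] by (simp add: a_minus_def M.M.a_ac M.M.r_neg M.M.r_neg2)
  have kk: "?k (?k x) = ?k x" if x: "x \<in> carrier M" for x
    using x fc[OF x] by (subst ker) (auto simp: rmod_hom_minus[OF f M M] idem M.M.minus_eq_zero_iff)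
  have "?A \<inter> ?B = {\<zero>\<^bsub>M\<^esub>}"
    using ker rmod_hom_zero[OF f M M] by force
  moreover have "?A <+>\<^bsub>M\<^esub> ?B = carrier M"
  proof
    show "?A <+>\<^bsub>M\<^esub> ?B \<subseteq> carrier M" by (auto simp: set_add_def')
    show "carrier M \<subseteq> ?A <+>\<^bsub>M\<^esub> ?B"
    proof
      fix x assume x: "x \<in> carrier M"
      have "f x \<in> ?A" "?k x \<in> ?B" using x fc idem kk by auto
      with dec[OF x] show "x \<in> ?A <+>\<^bsub>M\<^esub> ?B" unfolding set_add_def' by blast
    qed
  qed
  ultimately show ?thesis
    unfolding direct_summand_def
    using right_module_fixed_points[OF M f] right_module_fixed_points[OF M k]
    by (intro conjI exI[of _ "M\<lparr>carrier := ?B\<rparr>"] is_submodule_restrict M) auto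
qed

section \<open>Finite powers and the class \<open>add[M]\<close>\<close>

lemma right_module_rmod_power:
  assumes M: "right_module R M"
  shows "right_module R (rmod_power M n)"
proof -
  interpret M: right_module R M by fact
  note [simp] = rmod_power_def
  have "abelian_group (rmod_power M n)"
  proof (rule abelian_groupI)
    fix f g h assume "f \<in> carrier (rmod_power M n)" "g \<in> carrier (rmod_power M n)"
      "h \<in> carrier (rmod_power M n)"
    then show "f \<oplus>\<^bsub>rmod_power M n\<^esub> g \<oplus>\<^bsub>rmod_power M n\<^esub> h =
        f \<oplus>\<^bsub>rmod_power M n\<^esub> (g \<oplus>\<^bsub>rmod_power M n\<^esub> h)"
      by (auto simp: fun_eq_iff PiE_iff M.M.a_assoc restrict_def extensional_def)
  next
    fix f assume f: "f \<in> carrier (rmod_power M n)"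
    then show "\<zero>\<^bsub>rmod_power M n\<^esub> \<oplus>\<^bsub>rmod_power M n\<^esub> f = f"
      by (auto simp: fun_eq_iff PiE_iff restrict_def extensional_def)
    show "\<exists>g\<in>carrier (rmod_power M n). g \<oplus>\<^bsub>rmod_power M n\<^esub> f = \<zero>\<^bsub>rmod_power M n\<^esub>"
      using f by (intro bexI[of _ "\<lambda>i\<in>{..<n}. \<ominus>\<^bsub>M\<^esub> f i"])
        (auto simp: fun_eq_iff PiE_iff restrict_def extensional_def M.M.l_neg)
  qed (auto simp: fun_eq_iff PiE_iff M.M.a_comm restrict_def extensional_def)
  then show ?thesis
    by (intro right_module.intro right_module_axioms.intro)
      (auto simp: fun_eq_iff PiE_iff restrict_def extensional_def M.smult_closed M.smult_distr_ring
        M.smult_distr_module M.smult_assoc M.smult_one M.R.ring_axioms)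
qed

lemma is_submodule_rmod_power:
  assumes "is_submodule R A M"
  shows "is_submodule R (rmod_power A n) (rmod_power M n)"
proof -
  have A: "right_module R A" and M: "right_module R M" and sub: "carrier A \<subseteq> carrier M"
    and i: "(\<lambda>x. x) \<in> rmod_hom R A M"
    using assms by (auto simp: is_submodule_def)
  have "(\<lambda>x. x) \<in> rmod_hom R (rmod_power A n) (rmod_power M n)"
    using sub rmod_hom_add[OF i] rmod_hom_smult[OF i]
    by (intro rmod_homI) (auto simp: rmod_power_def fun_eq_iff PiE_iff restrict_def)
  then show ?thesis
    using right_module_rmod_power[OF A] right_module_rmod_power[OF M] sub
    by (auto simp: is_submodule_def rmod_power_def PiE_iff)
qed

text \<open>If \<open>B\<close> is a complement of \<open>A\<close>, the corresponding power of
  \<open>B\<close> is a complement of the power of \<open>A\<close>, because intersections and sums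
  are computed coordinatewise.\<close>

lemma direct_summand_rmod_power:
  assumes "direct_summand R A M"
  shows "direct_summand R (rmod_power A n) (rmod_power M n)"
proof -
  obtain B where A: "is_submodule R A M" and B: "is_submodule R B M"
    and int: "carrier A \<inter> carrier B = {\<zero>\<^bsub>M\<^esub>}" and sum: "carrier A <+>\<^bsub>M\<^esub> carrier B = carrier M"
    using assms by (auto simp: direct_summand_def)
  have "carrier (rmod_power A n) \<inter> carrier (rmod_power B n) = {\<zero>\<^bsub>rmod_power M n\<^esub>}"
  proof -
    have "carrier (rmod_power A n) \<inter> carrier (rmod_power B n) =
        {..<n} \<rightarrow>\<^sub>E (carrier A \<inter> carrier B)"
      by (auto simp: rmod_power_def PiE_iff)
    also have "\<dots> = {\<zero>\<^bsub>rmod_power M n\<^esub>}"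
      unfolding int by (auto simp: rmod_power_def PiE_iff fun_eq_iff restrict_def extensional_def)
    finally show ?thesis .
  qed
  moreover have "carrier (rmod_power A n) <+>\<^bsub>rmod_power M n\<^esub> carrier (rmod_power B n) =
      carrier (rmod_power M n)"
  proof
    show "carrier (rmod_power A n) <+>\<^bsub>rmod_power M n\<^esub> carrier (rmod_power B n)
        \<subseteq> carrier (rmod_power M n)"
    proof -
      have "a \<oplus>\<^bsub>M\<^esub> b \<in> carrier M" if "a \<in> carrier A" "b \<in> carrier B" for a b
        using that sum by (auto simp: set_add_def')
      then show ?thesis by (auto simp: rmod_power_def set_add_def' PiE_iff)
    qed
    show "carrier (rmod_power M n) \<subseteq>
        carrier (rmod_power A n) <+>\<^bsub>rmod_power M n\<^esub> carrier (rmod_power B n)"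
    proof
      fix f assume f: "f \<in> carrier (rmod_power M n)"
      have "\<forall>i<n. \<exists>a b. a \<in> carrier A \<and> b \<in> carrier B \<and> f i = a \<oplus>\<^bsub>M\<^esub> b"
        using f sum by (fastforce simp: rmod_power_def set_add_def' PiE_iff)
      then obtain a b where ab: "\<And>i. i < n \<Longrightarrow> a i \<in> carrier A \<and> b i \<in> carrier B \<and>
          f i = a i \<oplus>\<^bsub>M\<^esub> b i"
        by metis
      \<comment> \<open>Elements of a power are extensional functions, so the chosen coordinates
        have to be cut off outside \<open>{..<n}\<close>.\<close>
      have "restrict a {..<n} \<in> carrier (rmod_power A n)"
        "restrict b {..<n} \<in> carrier (rmod_power B n)"
        "f = restrict a {..<n} \<oplus>\<^bsub>rmod_power M n\<^esub> restrict b {..<n}"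
        using f ab by (auto simp: rmod_power_def PiE_iff fun_eq_iff restrict_def extensional_def)
      then show "f \<in> carrier (rmod_power A n) <+>\<^bsub>rmod_power M n\<^esub> carrier (rmod_power B n)"
        unfolding set_add_def' by blast
    qed
  qed
  ultimately show ?thesis
    unfolding direct_summand_def using A B is_submodule_rmod_power by blast
qed

text \<open>Exponent 1 suffices: \<open>A\<close> is isomorphic to its first power, which is a
  summand of the first power of \<open>M\<close>.\<close>

lemma direct_summand_in_add_class:
  assumes D: "direct_summand R A M" and A: "A \<in> right_modules R"
  shows "A \<in> add_class R M"
proof -
  let ?c = "\<lambda>x. \<lambda>i\<in>{..<1::nat}. x"
  have "?c \<in> rmod_iso R A (rmod_power A 1)"
  proof -
    have "?c \<in> rmod_hom R A (rmod_power A 1)"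
      by (intro rmod_homI) (auto simp: rmod_power_def fun_eq_iff)
    moreover have "bij_betw ?c (carrier A) (carrier (rmod_power A 1))"
    proof (rule bij_betw_byWitness[where f' = "\<lambda>f. f 0"])
      show "\<forall>f\<in>carrier (rmod_power A 1). ?c (f 0) = f"
      \<comment> \<open>At index 0 both sides agree by evaluation; at every other index both are
        \<open>undefined\<close> by extensionality.\<close>
      proof (intro ballI ext)
        fix f i assume "f \<in> carrier (rmod_power A 1)"
        then have "f \<in> {..<1} \<rightarrow>\<^sub>E carrier A" by (simp add: rmod_power_def)
        from PiE_arb[OF this, of i] show "?c (f 0) i = f i"
          by (cases "i = 0") auto
      qed
    qed (simp_all add: rmod_power_def image_subset_iff restrict_PiE_iff PiE_iff)
    ultimately show ?thesis by (simp add: rmod_iso_def)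
  qed
  then have "rmod_isomorphic R A (rmod_power A 1)" by (auto simp: rmod_isomorphic_def)
  with direct_summand_rmod_power[OF D, of 1] A show ?thesis
    unfolding add_class_def by blast
qed

section \<open>Directed unions\<close>

text \<open>A map out of a directed union is obtained by gluing: evaluate the cocone at any stage
  containing the element. Compatibility with a later common stage makes the value independent of the
  choice, and since the stages exhaust \<open>L\<close> the map is unique.\<close>

lemma
  assumes I: "directed_set I r" and A: "\<And>i. i \<in> I \<Longrightarrow> A i \<in> right_modules R"
    and L: "L \<in> right_modules R" and sub: "\<And>i. i \<in> I \<Longrightarrow> is_submodule R (A i) L"
    and mono: "\<And>i j. \<lbrakk>i \<in> I; j \<in> I; r i j\<rbrakk> \<Longrightarrow> carrier (A i) \<subseteq> carrier (A j)"
  shows direct_system_submodules: "direct_system R I r A (\<lambda>_ _ x. x)"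
    and direct_limit_submodules:
      "carrier L = (\<Union>i\<in>I. carrier (A i)) \<Longrightarrow> direct_limit R I r A (\<lambda>_ _ x. x) L (\<lambda>_ x. x)"
proof -
  have AL: "(\<lambda>x. x) \<in> rmod_hom R (A i) L" if "i \<in> I" for i
    using sub[OF that] by (simp add: is_submodule_def)
  have rm: "right_module R (A i)" if "i \<in> I" for i
    using sub[OF that] by (simp add: is_submodule_def)
  \<comment> \<open>Only the carriers of \<open>A i\<close> and \<open>A j\<close> are assumed
    nested. Their operations agree because both are restricted from \<open>L\<close>.\<close>
  have "(\<lambda>x. x) \<in> rmod_hom R (A i) (A j)" if ij: "i \<in> I" "j \<in> I" "r i j" for i j
  proof (rule rmod_homI)
    fix x y assume xy: "x \<in> carrier (A i)" "y \<in> carrier (A i)"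
    then have xy': "x \<in> carrier (A j)" "y \<in> carrier (A j)" using mono[OF ij] by auto
    show "x \<oplus>\<^bsub>A i\<^esub> y = x \<oplus>\<^bsub>A j\<^esub> y"
      using rmod_hom_add[OF AL[OF ij(1)] xy] rmod_hom_add[OF AL[OF ij(2)] xy'] by simp
  next
    fix a x assume a: "a \<in> carrier R" and x: "x \<in> carrier (A i)"
    then have x': "x \<in> carrier (A j)" using mono[OF ij] by auto
    show "a \<odot>\<^bsub>A i\<^esub> x = a \<odot>\<^bsub>A j\<^esub> x"
      using rmod_hom_smult[OF AL[OF ij(1)] a x] rmod_hom_smult[OF AL[OF ij(2)] a x'] by simp
  qed (use mono[OF ij] in auto)
  then show "direct_system R I r A (\<lambda>_ _ x. x)"
    by (simp add: direct_system_def I A)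
  have "\<forall>i\<in>I. \<forall>j\<in>I. \<exists>k\<in>I. r i k \<and> r j k"
    using I unfolding directed_set_def by (elim conjE)
  then have directed: "\<exists>k\<in>I. r i k \<and> r j k" if "i \<in> I" "j \<in> I" for i j
    using that by blast
  assume un: "carrier L = (\<Union>i\<in>I. carrier (A i))"
  \<comment> \<open>Additivity of the glued map is checked inside one stage, so both summands must
    be brought there.\<close>
  have common: "\<exists>i\<in>I. x \<in> carrier (A i) \<and> y \<in> carrier (A i)"
    if xy: "x \<in> carrier L" "y \<in> carrier L" for x y
  proof -
    obtain i j where ij: "i \<in> I" "j \<in> I" "x \<in> carrier (A i)" "y \<in> carrier (A j)"
      using xy unfolding un by blast
    obtain k where k: "k \<in> I" "r i k" "r j k" using directed[OF ij(1,2)] by blast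
    then have "x \<in> carrier (A k)" "y \<in> carrier (A k)"
      using mono[OF ij(1) k(1,2)] mono[OF ij(2) k(1,3)] ij(3,4) by (simp_all only: subset_iff)
    with k(1) show ?thesis by (intro bexI[of _ k] conjI)
  qed
  have fac: "\<exists>h\<in>rmod_hom R L P. \<forall>i\<in>I. \<forall>x\<in>carrier (A i). h x = \<beta> i x"
    if co: "cocone R I r A (\<lambda>_ _ x. x) P \<beta>" for P \<beta>
  proof -
    have \<beta>: "\<beta> i \<in> rmod_hom R (A i) P" if "i \<in> I" for i
      using co that by (simp add: cocone_def)
    have cmp: "\<beta> j x = \<beta> i x" if "i \<in> I" "j \<in> I" "r i j" "x \<in> carrier (A i)" for i j x
      using co that by (simp add: cocone_def)
    have indep: "\<beta> i x = \<beta> j x"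
      if ij: "i \<in> I" "j \<in> I" and x: "x \<in> carrier (A i)" "x \<in> carrier (A j)" for i j x
    proof -
      obtain k where "k \<in> I" "r i k" "r j k" using directed[OF ij] by blast
      then show ?thesis using cmp[of i k x] cmp[of j k x] ij x by simp
    qed
    \<comment> \<open>An arbitrary stage containing \<open>x\<close> is picked; \<open>indep\<close>
      makes the pick irrelevant.\<close>
    define h where "h x = \<beta> (SOME i. i \<in> I \<and> x \<in> carrier (A i)) x" for x
    have h: "h x = \<beta> i x" if "i \<in> I" "x \<in> carrier (A i)" for i x
    proof -
      have "(SOME i. i \<in> I \<and> x \<in> carrier (A i)) \<in> I \<and>
          x \<in> carrier (A (SOME i. i \<in> I \<and> x \<in> carrier (A i)))"
        by (rule someI[of _ i]) (use that in simp)
      then show ?thesis unfolding h_def using indep that by blast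
    qed
    have "h \<in> rmod_hom R L P"
    proof (rule rmod_homI)
      fix x assume "x \<in> carrier L"
      then obtain i where "i \<in> I" "x \<in> carrier (A i)" unfolding un by blast
      then show "h x \<in> carrier P" using h[of i x] rmod_hom_closed[OF \<beta>] by simp
    next
      fix x y assume "x \<in> carrier L" "y \<in> carrier L"
      then obtain i where i: "i \<in> I" and xy: "x \<in> carrier (A i)" "y \<in> carrier (A i)"
        using common by blast
      interpret Ai: right_module R "A i" by (rule rm[OF i])
      have "h (x \<oplus>\<^bsub>A i\<^esub> y) = h x \<oplus>\<^bsub>P\<^esub> h y"
        using h[OF i] xy rmod_hom_add[OF \<beta>[OF i]] by simp
      then show "h (x \<oplus>\<^bsub>L\<^esub> y) = h x \<oplus>\<^bsub>P\<^esub> h y"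
        using rmod_hom_add[OF AL[OF i] xy] by simp
    next
      fix a x assume a: "a \<in> carrier R" and "x \<in> carrier L"
      then obtain i where i: "i \<in> I" and x: "x \<in> carrier (A i)" unfolding un by blast
      interpret Ai: right_module R "A i" by (rule rm[OF i])
      have "h (a \<odot>\<^bsub>A i\<^esub> x) = a \<odot>\<^bsub>P\<^esub> h x"
        using h[OF i] x a Ai.smult_closed rmod_hom_smult[OF \<beta>[OF i]] by simp
      then show "h (a \<odot>\<^bsub>L\<^esub> x) = a \<odot>\<^bsub>P\<^esub> h x"
        using rmod_hom_smult[OF AL[OF i] a x] by simp
    qed
    with h show ?thesis by blast
  qed
  have "cocone R I r A (\<lambda>_ _ x. x) L (\<lambda>_ x. x)"
    using L AL by (simp add: cocone_def)
  then show "direct_limit R I r A (\<lambda>_ _ x. x) L (\<lambda>_ x. x)"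
    unfolding direct_limit_def
  proof (intro conjI allI impI ballI)
    fix P \<beta> h h' y
    assume "\<forall>i\<in>I. \<forall>x\<in>carrier (A i). h x = \<beta> i x" "\<forall>i\<in>I. \<forall>x\<in>carrier (A i). h' x = \<beta> i x"
      and "y \<in> carrier L"
    then show "h y = h' y" using un by auto
  qed (assumption | rule fac, assumption)+
qed


section \<open>Splittings induced on envelopes\<close>

lemma preenvelopeD:
  assumes "preenvelope R \<C> M X u"
  shows preenvelope_mem: "X \<in> \<C>" and preenvelope_hom: "u \<in> rmod_hom R M X"
    and preenvelope_factor:
      "\<And>X' g. \<lbrakk>X' \<in> \<C>; g \<in> rmod_hom R M X'\<rbrakk> \<Longrightarrow>
        \<exists>h\<in>rmod_hom R X X'. \<forall>x\<in>carrier M. h (u x) = g x"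
  using assms unfolding preenvelope_def by simp_all

lemma envelopeD:
  assumes "envelope R \<C> M X u"
  shows envelope_preenvelope: "preenvelope R \<C> M X u"
    and envelope_rmod_iso:
      "\<And>h. \<lbrakk>h \<in> rmod_hom R X X; \<And>x. x \<in> carrier M \<Longrightarrow> h (u x) = u x\<rbrakk> \<Longrightarrow> h \<in> rmod_iso R X X"
  using assms unfolding envelope_def by simp_all

lemma strongly_pure_monoD:
  assumes "strongly_pure_mono R \<C> N M u"
  shows strongly_pure_mono_hom: "u \<in> rmod_hom R N M"
    and strongly_pure_mono_extend:
      "\<And>X f. \<lbrakk>X \<in> \<C>; f \<in> rmod_hom R N X\<rbrakk> \<Longrightarrow>
        \<exists>g\<in>rmod_hom R M X. \<forall>x\<in>carrier N. g (u x) = f x"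
  using assms unfolding strongly_pure_mono_def by simp_all

text \<open>The map \<open>j\<close> factors \<open>w i\<close> through the envelope
  \<open>v\<close>. In the other direction, \<open>v\<close> extends along \<open>i\<close> by
  purity and then factors through \<open>w\<close>, which gives \<open>s\<close>. The composite
  \<open>s j\<close> fixes \<open>v\<close>, hence is an automorphism of \<open>X\<close>, and
  correcting \<open>s\<close> by its inverse gives the retraction \<open>r\<close>.\<close>

lemma strongly_pure_mono_split_envelope:
  assumes env: "envelope R \<C> A X v" and pre: "preenvelope R \<C> B Z w"
    and i: "strongly_pure_mono R \<C> A B i" and X: "right_module R X"
  obtains j r where "j \<in> rmod_hom R X Z" "r \<in> rmod_hom R Z X"
    "\<And>x. x \<in> carrier A \<Longrightarrow> j (v x) = w (i x)" "\<And>x. x \<in> carrier A \<Longrightarrow> r (w (i x)) = v x"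
    "\<And>y. y \<in> carrier X \<Longrightarrow> r (j y) = y"
proof -
  note env_pre = envelope_preenvelope[OF env]
  note v = preenvelope_hom[OF env_pre] and w = preenvelope_hom[OF pre]
    and iAB = strongly_pure_mono_hom[OF i] and XC = preenvelope_mem[OF env_pre]
  obtain j where j: "j \<in> rmod_hom R X Z" "\<And>x. x \<in> carrier A \<Longrightarrow> j (v x) = w (i x)"
    using preenvelope_factor[OF env_pre preenvelope_mem[OF pre] rmod_hom_compose[OF w iAB]] by blast
  obtain g where g: "g \<in> rmod_hom R B X" "\<And>x. x \<in> carrier A \<Longrightarrow> g (i x) = v x"
    using strongly_pure_mono_extend[OF i XC v] by blast
  obtain s where s: "s \<in> rmod_hom R Z X" "\<And>x. x \<in> carrier B \<Longrightarrow> s (w x) = g x"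
    using preenvelope_factor[OF pre XC g(1)] by blast
  have sw: "s (w (i x)) = v x" if "x \<in> carrier A" for x
    using that s(2) g(2) rmod_hom_closed[OF iAB] by simp
  let ?t = "\<lambda>y. s (j y)"
  have t: "?t \<in> rmod_iso R X X"
    by (rule envelope_rmod_iso[OF env rmod_hom_compose[OF s(1) j(1)]]) (simp add: j(2) sw)
  obtain t' where t': "t' \<in> rmod_hom R X X" and inv: "\<And>y. y \<in> carrier X \<Longrightarrow> t' (?t y) = y"
    by (rule rmod_iso_inverse[OF t X]) blast
  \<comment> \<open>The correction does no harm on the image of \<open>A\<close>: \<open>s j\<close>
    fixes \<open>v x\<close>, so its inverse \<open>t'\<close> does as well.\<close>
  have t's: "t' (s (w (i x))) = v x" if x: "x \<in> carrier A" for x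
    using inv[OF rmod_hom_closed[OF v x]] by (simp only: j(2)[OF x])
  show thesis
    by (rule that[OF j(1) rmod_hom_compose[OF t' s(1)] j(2) t's inv])
qed

text \<open>The envelope \<open>Y\<close> of \<open>P\<close> is a summand of \<open>E\<close> via
  \<open>a\<close> and \<open>b\<close>, and \<open>q\<close> is the endomorphism of
  \<open>N\<close> below the idempotent \<open>a b\<close>. Although \<open>q N\<close> need not be
  an envelope of \<open>P\<close>, it inherits its rigidity: an \<open>h\<close> that fixes
  \<open>P\<close> and is the identity modulo \<open>q N\<close> induces an automorphism of
  \<open>Y\<close>, whose inverse is brought back to \<open>N\<close> by endomorphism
  invariance.\<close>

lemma strongly_pure_submodule_hull:
  assumes inv: "endomorphism_invariant R \<C> N E v" and P: "strongly_pure_submodule R \<C> P N"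
    and env: "envelope R \<C> P Y w" and E: "right_module R E" and Y: "right_module R Y"
  obtains q where "q \<in> rmod_hom R N N" "\<And>x. x \<in> carrier P \<Longrightarrow> q x = x"
    "\<And>x. x \<in> carrier N \<Longrightarrow> q (q x) = q x"
    "\<forall>h\<in>rmod_hom R N N. (\<forall>x\<in>carrier P. h x = x) \<longrightarrow>
      (\<forall>x\<in>carrier N. h x \<ominus>\<^bsub>N\<^esub> q (h x) = x \<ominus>\<^bsub>N\<^esub> q x) \<longrightarrow> bij_betw h (carrier N) (carrier N)"
proof -
  have N: "right_module R N" and PN: "carrier P \<subseteq> carrier N"
    and pure: "strongly_pure_mono R \<C> P N (\<lambda>x. x)"
    using P by (simp_all add: strongly_pure_submodule_def is_submodule_def)
  interpret N: right_module R N by fact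
  interpret E: right_module R E by fact
  have pre: "preenvelope R \<C> N E v" and inj: "inj_on v (carrier N)"
    and lift: "\<And>f. f \<in> rmod_hom R E E \<Longrightarrow>
      \<exists>g\<in>rmod_hom R N N. \<forall>x\<in>carrier N. v (g x) = f (v x)"
    using inv by (simp_all add: endomorphism_invariant_def mono_envelope_def envelope_def)
  note v = preenvelope_hom[OF pre] and EC = preenvelope_mem[OF pre]
  note vc = rmod_hom_closed[OF v]
  have v_eq: "x = y" if "v x = v y" "x \<in> carrier N" "y \<in> carrier N" for x y
    using that inj by (auto dest: inj_onD)
  obtain a b where a: "a \<in> rmod_hom R Y E" and b: "b \<in> rmod_hom R E Y"
    and aw: "\<And>x. x \<in> carrier P \<Longrightarrow> a (w x) = v x"
    and bv: "\<And>x. x \<in> carrier P \<Longrightarrow> b (v x) = w x"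
    and ba: "\<And>y. y \<in> carrier Y \<Longrightarrow> b (a y) = y"
    using strongly_pure_mono_split_envelope[OF env pre pure Y] by metis
  note bc = rmod_hom_closed[OF b]
  obtain q where q: "q \<in> rmod_hom R N N" and vq: "\<And>x. x \<in> carrier N \<Longrightarrow> v (q x) = a (b (v x))"
    using lift[OF rmod_hom_compose[OF a b]] by blast
  note qc = rmod_hom_closed[OF q]
  have qP: "q x = x" if x: "x \<in> carrier P" for x
    \<comment> \<open>Identities in \<open>N\<close> are tested after applying the injective
      \<open>v\<close>, where \<open>q\<close> becomes \<open>a b\<close>.\<close>
    using x PN qc by (intro v_eq) (auto simp: vq bv aw)
  have qq: "q (q x) = q x" if x: "x \<in> carrier N" for x
    using x qc by (intro v_eq) (auto simp: vq ba bc vc)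
  have bij: "bij_betw h (carrier N) (carrier N)"
    if h: "h \<in> rmod_hom R N N" and hP: "\<And>x. x \<in> carrier P \<Longrightarrow> h x = x"
      and hq: "\<And>x. x \<in> carrier N \<Longrightarrow> h x \<ominus>\<^bsub>N\<^esub> q (h x) = x \<ominus>\<^bsub>N\<^esub> q x" for h
  proof -
    note hc = rmod_hom_closed[OF h]
    obtain h' where h': "h' \<in> rmod_hom R E E" and h'v: "\<And>x. x \<in> carrier N \<Longrightarrow> h' (v x) = v (h x)"
      using preenvelope_factor[OF pre EC rmod_hom_compose[OF v h]] by blast
    \<comment> \<open>The extension \<open>h'\<close> of \<open>h\<close> to \<open>E\<close> is
      compressed to the summand \<open>Y\<close>. The result fixes \<open>w\<close>, since
      \<open>h\<close> fixes \<open>P\<close>, so the envelope property makes it an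
      automorphism.\<close>
    let ?t = "\<lambda>y. b (h' (a y))"
    have "?t \<in> rmod_hom R Y Y" by (intro rmod_hom_compose[OF b] rmod_hom_compose[OF h'] a)
    moreover have "?t (w x) = w x" if "x \<in> carrier P" for x
      using that PN by (auto simp: aw h'v hP bv)
    ultimately have t: "?t \<in> rmod_iso R Y Y"
      by (rule envelope_rmod_iso[OF env])
    obtain s where s: "s \<in> rmod_hom R Y Y"
      and st: "\<And>y. y \<in> carrier Y \<Longrightarrow> s (?t y) = y" and ts: "\<And>y. y \<in> carrier Y \<Longrightarrow> ?t (s y) = y"
      by (rule rmod_iso_inverse[OF t Y]) blast
    \<comment> \<open>On fixed points of \<open>q\<close> the right-hand side of \<open>hq\<close>
      vanishes, so \<open>h\<close> maps \<open>q N\<close> into itself.\<close>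
    have qh: "q (h x) = h x" if x: "x \<in> carrier N" "q x = x" for x
      using hq[OF x(1)] x qc hc N.M.minus_eq_zero_iff by metis
    \<comment> \<open>A kernel element lies in \<open>q N\<close> by \<open>hq\<close>. There
      \<open>b v\<close> carries \<open>h\<close> to the automorphism \<open>?t\<close>, so
      \<open>b (v x) = b (v 0)\<close>, and applying \<open>a\<close> gives
      \<open>q x = q 0\<close>.\<close>
    have inj_h: "x = \<zero>\<^bsub>N\<^esub>" if x: "x \<in> carrier N" and hx: "h x = \<zero>\<^bsub>N\<^esub>" for x
    proof -
      have "q x = x"
        using hq[OF x] x qc[OF x] hx rmod_hom_zero[OF q N N] N.M.minus_eq_zero_iff
        by (metis N.M.zero_closed)
      then have abv: "a (b (v x)) = v x" using vq[OF x] by simp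
      then have "?t (b (v x)) = b (v (h x))" using h'v[OF x] by simp
      also have "\<dots> = b (v (h \<zero>\<^bsub>N\<^esub>))" by (simp add: hx rmod_hom_zero[OF h N N])
      also have "\<dots> = ?t (b (v \<zero>\<^bsub>N\<^esub>))"
        using h'v vq[of "\<zero>\<^bsub>N\<^esub>"] rmod_hom_zero[OF q N N] by simp
      finally have "b (v x) = b (v \<zero>\<^bsub>N\<^esub>)"
        using st bc vc x by (metis N.M.zero_closed)
      then have "q x = q \<zero>\<^bsub>N\<^esub>" using x qc by (intro v_eq) (auto simp: vq)
      then show ?thesis using \<open>q x = x\<close> rmod_hom_zero[OF q N N] by simp
    qed
    have "inj_on h (carrier N)"
    proof (rule inj_onI)
      fix x y assume x: "x \<in> carrier N" and y: "y \<in> carrier N" and "h x = h y"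
      then have "h (x \<ominus>\<^bsub>N\<^esub> y) = \<zero>\<^bsub>N\<^esub>"
        using rmod_hom_minus[OF h N N x y] hc[OF x] N.M.minus_eq_zero_iff by metis
      then show "x = y" using inj_h x y N.M.minus_eq_zero_iff by (metis N.M.minus_closed)
    qed
    moreover have "carrier N \<subseteq> h ` carrier N"
    proof
      fix y assume y: "y \<in> carrier N"
      \<comment> \<open>The error \<open>y - h y\<close> lies in \<open>q N\<close>. It therefore
        suffices to find a preimage of it under \<open>h\<close> and add that preimage to
        \<open>y\<close>.\<close>
      let ?z = "y \<ominus>\<^bsub>N\<^esub> h y"
      have z: "?z \<in> carrier N" using y hc by simp
      have "y \<ominus>\<^bsub>N\<^esub> q y = h y \<ominus>\<^bsub>N\<^esub> q (h y)" using hq y by simp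
      then have qz: "q ?z = ?z"
        using N.M.minus_swap_inner[of y "q y" "h y" "q (h y)"] y hc qc qq rmod_hom_minus[OF q N N]
        by simp
      \<comment> \<open>The inverse \<open>s\<close> of \<open>?t\<close> lives on \<open>Y\<close>;
        its extension \<open>a s b\<close> to \<open>E\<close> restricts to \<open>N\<close> by
        endomorphism invariance and produces the preimage.\<close>
      obtain g where g: "g \<in> rmod_hom R N N"
        and vg: "\<And>x. x \<in> carrier N \<Longrightarrow> v (g x) = a (s (b (v x)))"
        using lift[OF rmod_hom_compose[OF a rmod_hom_compose[OF s b]]] by blast
      let ?x = "g ?z"
      have x: "?x \<in> carrier N" using rmod_hom_closed[OF g z] .
      have sz: "s (b (v ?z)) \<in> carrier Y" using rmod_hom_closed[OF s] bc vc z by simp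
      have qx: "q ?x = ?x" using qc[OF x] x sz z by (intro v_eq) (auto simp: vq vg ba)
      have "v (h ?x) = v (q (h ?x))" using qh[OF x qx] by simp
      also have "\<dots> = a (b (h' (a (s (b (v ?z))))))"
        using vq[OF hc[OF x]] h'v[OF x] vg[OF z] by simp
      also have "\<dots> = v ?z" using ts[OF bc[OF vc[OF z]]] vq[OF z] qz by simp
      finally have "h ?x = ?z" using v_eq hc x z by blast
      then have "h (?x \<oplus>\<^bsub>N\<^esub> y) = y"
        using rmod_hom_add[OF h x y] y hc[OF y] by (simp add: a_minus_def N.M.a_assoc N.M.l_neg)
      then show "y \<in> h ` carrier N" using x y by (metis N.M.a_closed imageI)
    qed
    ultimately show ?thesis using hc by (auto simp: bij_betw_def)
  qed
  show thesis
    by (rule that[OF q qP qq]) (assumption | intro ballI impI | rule bij | drule (1) bspec)+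
qed

section \<open>The orbit of a complement\<close>

lemma strongly_purely_closedD:
  fixes I :: "'m set" and M :: "('r, 'm) module"
  assumes "strongly_purely_closed R \<C> M" and "I \<prec> (UNIV :: 'm set)"
    and "direct_system R I r A f" and "direct_system R I r B g"
    and "\<forall>i\<in>I. A i \<in> add_class R M \<and> B i \<in> add_class R M"
    and "direct_system_morphism R I r A f B g u"
    and "\<forall>i\<in>I. split_mono R (A i) (B i) (u i)"
    and "direct_limit R I r A f L \<alpha>" and "direct_limit R I r B g L' \<beta>"
    and "w \<in> rmod_hom R L L'"
    and "\<forall>i\<in>I. \<forall>x\<in>carrier (A i). w (\<alpha> i x) = \<beta> i (u i x)"
  shows "strongly_pure_mono R \<C> L L' w"
  by (rule assms(1)[unfolded strongly_purely_closed_def, THEN spec, THEN spec, THEN spec,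
        THEN spec, THEN spec, THEN spec, THEN spec, THEN spec, THEN spec, THEN spec, THEN spec,
        THEN spec, THEN mp, THEN mp, THEN mp, THEN mp, THEN mp, THEN mp, THEN mp, THEN mp, THEN mp,
        THEN mp, OF assms(2-)])

lemma right_modules_subset:
  assumes "M \<in> right_modules R" "right_module R A" "carrier A \<subseteq> carrier M"
  shows "A \<in> right_modules R"
  using assms subset_imp_lepoll lesspoll_trans1 unfolding right_modules_def by blast

text \<open>The relations make the maps \<open>u^i k p^i\<close> orthogonal idempotents. Their
  partial sums project onto an increasing chain of summands of \<open>N\<close> with union
  \<open>P\<close>, so \<open>P -> N\<close> is a direct limit of split monomorphisms within
  \<open>add[N]\<close>. The last conclusion records \<open>P = k P + u P\<close>
  elementwise.\<close>

lemma strongly_pure_orbit: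
  fixes N :: "('r, 'm) module"
  assumes NR: "N \<in> right_modules R" and closed: "strongly_purely_closed R \<C> N"
    and inf: "infinite (carrier N)"
    and k: "k \<in> rmod_hom R N N" and u: "u \<in> rmod_hom R N N" and p: "p \<in> rmod_hom R N N"
    and kk: "\<And>x. x \<in> carrier N \<Longrightarrow> k (k x) = k x"
    and ku: "\<And>x. x \<in> carrier N \<Longrightarrow> k (u x) = \<zero>\<^bsub>N\<^esub>"
    and pk: "\<And>x. x \<in> carrier N \<Longrightarrow> p (k x) = \<zero>\<^bsub>N\<^esub>"
    and pu: "\<And>x. x \<in> carrier N \<Longrightarrow> p (u x) = x"
  obtains P where "P \<in> right_modules R" "strongly_pure_submodule R \<C> P N"
    "\<And>x. x \<in> carrier N \<Longrightarrow> k x \<in> carrier P" "\<And>x. x \<in> carrier P \<Longrightarrow> u x \<in> carrier P"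
    "\<And>x. x \<in> carrier P \<Longrightarrow> p x \<in> carrier P"
    "\<And>x. x \<in> carrier P \<Longrightarrow> k x \<oplus>\<^bsub>N\<^esub> u (p x) = x"
proof -
  have N: "right_module R N" using NR by (simp add: right_modules_def)
  interpret N: right_module R N by fact
  note kc = rmod_hom_closed[OF k] and uc = rmod_hom_closed[OF u] and pc = rmod_hom_closed[OF p]
  \<comment> \<open>\<open>\<pi> n\<close> is the sum of the \<open>u\<^sup>i k p\<^sup>i\<close> for \<open>i < n\<close>, the projection onto the sum of the
    \<open>u\<^sup>i (k N)\<close>.\<close>
  define \<pi> where "\<pi> = rec_nat (\<lambda>_. \<zero>\<^bsub>N\<^esub>) (\<lambda>_ f x. k x \<oplus>\<^bsub>N\<^esub> u (f (p x)))"
  have \<pi>0: "\<pi> 0 = (\<lambda>_. \<zero>\<^bsub>N\<^esub>)" and \<pi>Suc: "\<pi> (Suc n) = (\<lambda>x. k x \<oplus>\<^bsub>N\<^esub> u (\<pi> n (p x)))" for n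
    by (simp_all add: \<pi>_def)
  have \<pi>: "\<pi> n \<in> rmod_hom R N N" for n
  proof (induction n)
    case 0
    show ?case unfolding \<pi>0 by (rule rmod_hom_const_zero[OF N])
  next
    case (Suc n)
    show ?case unfolding \<pi>Suc
      by (rule rmod_hom_sum[OF N k rmod_hom_compose[OF u rmod_hom_compose[OF Suc p]]])
  qed
  note \<pi>c = rmod_hom_closed[OF \<pi>]
  \<comment> \<open>Both uses come from one induction: \<open>d = 0\<close> is idempotence, and
    general \<open>d\<close> says that the images increase. In the step, \<open>k\<close> and
    \<open>p\<close> read off the two components of \<open>k x + u y\<close>.\<close>
  have \<pi>\<pi>: "\<pi> (n + d) (\<pi> n x) = \<pi> n x" if "x \<in> carrier N" for n d x
    using that
  proof (induction n arbitrary: x)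
    case 0
    show ?case by (simp add: \<pi>0 rmod_hom_zero[OF \<pi> N N])
  next
    case (Suc n)
    let ?y = "\<pi> n (p x)"
    have y: "?y \<in> carrier N" using Suc.prems pc \<pi>c by simp
    have "k (k x \<oplus>\<^bsub>N\<^esub> u ?y) = k x"
      using Suc.prems y by (simp add: rmod_hom_add[OF k] kc uc kk ku)
    moreover have "p (k x \<oplus>\<^bsub>N\<^esub> u ?y) = ?y"
      using Suc.prems y by (simp add: rmod_hom_add[OF p] kc uc pk pu)
    ultimately show ?case using Suc.IH[of "p x"] Suc.prems pc by (simp add: \<pi>Suc)
  qed
  have fix_mono: "\<pi> n x = x" if "\<pi> m x = x" "m \<le> n" "x \<in> carrier N" for m n x
    using \<pi>\<pi>[of x m "n - m"] that by simp
  \<comment> \<open>By idempotence \<open>A n\<close> is the image of \<open>\<pi> n\<close>, and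
    \<open>S\<close> is the union of this chain.\<close>
  define A where "A n = N\<lparr>carrier := {x \<in> carrier N. \<pi> n x = x}\<rparr>" for n
  define S where "S = {x \<in> carrier N. \<exists>n. \<pi> n x = x}"
  define P where "P = N\<lparr>carrier := S\<rparr>"
  have S_sub: "S \<subseteq> carrier N" by (auto simp: S_def)
  have P: "right_module R P"
    unfolding P_def
  proof (rule right_module_restrict[OF N S_sub])
    show "\<zero>\<^bsub>N\<^esub> \<in> S" by (auto simp: S_def \<pi>0 intro: exI[of _ 0])
  next
    fix x y assume x: "x \<in> S" and y: "y \<in> S"
    then obtain m n where mn: "\<pi> m x = x" "\<pi> n y = y" by (auto simp: S_def)
    have xy: "x \<in> carrier N" "y \<in> carrier N" using x y by (auto simp: S_def)
    have "\<pi> (max m n) x = x" "\<pi> (max m n) y = y"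
      using fix_mono[OF mn(1) _ xy(1)] fix_mono[OF mn(2) _ xy(2)] by auto
    then have "\<pi> (max m n) (x \<oplus>\<^bsub>N\<^esub> y) = x \<oplus>\<^bsub>N\<^esub> y" using xy by (simp add: rmod_hom_add[OF \<pi>])
    then show "x \<oplus>\<^bsub>N\<^esub> y \<in> S" using xy by (auto simp: S_def)
  next
    fix x assume "x \<in> S"
    then obtain n where "x \<in> carrier N" "\<pi> n x = x" by (auto simp: S_def)
    then show "\<ominus>\<^bsub>N\<^esub> x \<in> S"
      by (auto simp: S_def rmod_hom_a_inv[OF \<pi> N N] intro: exI[of _ n])
  next
    fix a x assume "a \<in> carrier R" "x \<in> S"
    then obtain n where "x \<in> carrier N" "\<pi> n x = x" by (auto simp: S_def)
    with \<open>a \<in> carrier R\<close> show "a \<odot>\<^bsub>N\<^esub> x \<in> S"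
      by (auto simp: S_def rmod_hom_smult[OF \<pi>] N.smult_closed intro: exI[of _ n])
  qed
  have P_sub: "is_submodule R P N"
    unfolding P_def by (rule is_submodule_restrict[OF N P[unfolded P_def] S_sub])
  have PR: "P \<in> right_modules R"
    using right_modules_subset[OF NR P] S_sub by (simp add: P_def)
  have A: "right_module R (A n)" for n
    unfolding A_def by (rule right_module_fixed_points[OF N \<pi>])
  have AR: "A n \<in> right_modules R" for n
    by (rule right_modules_subset[OF NR A]) (simp add: A_def)
  have A_sub_P: "is_submodule R (A n) P" for n
    unfolding is_submodule_def using A P
    by (auto simp: A_def P_def S_def rmod_hom_def)
  have "direct_summand R (A n) N" for n
    unfolding A_def using \<pi>\<pi>[of _ n 0] by (intro direct_summand_fixed_points[OF N \<pi>]) simp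
  then have A_add: "A n \<in> add_class R N" for n
    using AR by (rule direct_summand_in_add_class)
  \<comment> \<open>\<open>N\<close> is its own summand, as the set of fixed points of the
    identity.\<close>
  have "direct_summand R (N\<lparr>carrier := {x \<in> carrier N. x = x}\<rparr>) N"
    by (rule direct_summand_fixed_points[OF N rmod_hom_id]) simp
  then have N_add: "N \<in> add_class R N"
    using direct_summand_in_add_class NR by simp
  have A_split: "split_mono R (A n) N (\<lambda>x. x)" for n
    unfolding split_mono_def
  proof (intro conjI bexI[of _ "\<pi> n"] ballI)
    show "(\<lambda>x. x) \<in> rmod_hom R (A n) N" by (auto simp: A_def rmod_hom_def)
    show "\<pi> n \<in> rmod_hom R N (A n)"
      using \<pi>[of n] \<pi>\<pi>[of _ n 0] by (auto simp: A_def rmod_hom_def)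
  qed (simp add: A_def)
  \<comment> \<open>The chain is indexed by the natural numbers, but index sets must be small
    subsets of \<open>'m\<close>. An infinite carrier contains a copy of the naturals, which is
    small because the carrier of \<open>N\<close> is.\<close>
  obtain \<iota> :: "nat \<Rightarrow> 'm" where \<iota>: "inj \<iota>" "range \<iota> \<subseteq> carrier N"
    using infinite_countable_subset[OF inf] by blast
  define I where "I = range \<iota>"
  define idx where "idx = inv_into UNIV \<iota>"
  define r where "r i j \<longleftrightarrow> idx i \<le> idx j" for i j
  have idx: "idx (\<iota> n) = n" for n using \<iota>(1) by (simp add: idx_def)
  have I_small: "I \<prec> (UNIV :: 'm set)"
    using NR subset_imp_lepoll[OF \<iota>(2)] lesspoll_trans1 unfolding I_def right_modules_def by blast
  have dir: "directed_set I r"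
    unfolding directed_set_def
  proof (intro conjI ballI impI)
    fix i j assume "i \<in> I" "j \<in> I"
    show "\<exists>k\<in>I. r i k \<and> r j k"
      by (rule bexI[of _ "\<iota> (max (idx i) (idx j))"]) (simp_all add: r_def idx I_def)
  qed (auto simp: r_def I_def)
  have A_mono: "carrier (A (idx i)) \<subseteq> carrier (A (idx j))" if "r i j" for i j
    using that fix_mono by (auto simp: A_def r_def)
  have P_union: "carrier P = (\<Union>i\<in>I. carrier (A (idx i)))"
    by (auto simp: P_def S_def A_def I_def idx)
  have N_union: "carrier N = (\<Union>i\<in>I. carrier N)" by (simp add: I_def)
  have N_sub: "is_submodule R N N" by (simp add: is_submodule_def N rmod_hom_id)
  \<comment> \<open>The second system is constant at \<open>N\<close>, its own limit as a union over
    the nonempty \<open>I\<close>. Each inclusion of a stage is split by the corresponding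
    \<open>\<pi> n\<close>.\<close>
  have "strongly_pure_mono R \<C> P N (\<lambda>x. x)"
  proof (rule strongly_purely_closedD[OF closed I_small])
    show "direct_system R I r (\<lambda>i. A (idx i)) (\<lambda>_ _ x. x)"
      using direct_system_submodules[OF dir AR PR A_sub_P A_mono] .
    show "direct_system R I r (\<lambda>_. N) (\<lambda>_ _ x. x)"
      using direct_system_submodules[OF dir NR NR N_sub subset_refl] .
    show "direct_limit R I r (\<lambda>i. A (idx i)) (\<lambda>_ _ x. x) P (\<lambda>_ x. x)"
      using direct_limit_submodules[OF dir AR PR A_sub_P A_mono P_union] .
    show "direct_limit R I r (\<lambda>_. N) (\<lambda>_ _ x. x) N (\<lambda>_ x. x)"
      using direct_limit_submodules[OF dir NR NR N_sub subset_refl N_union] .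
    show "direct_system_morphism R I r (\<lambda>i. A (idx i)) (\<lambda>_ _ x. x) (\<lambda>_. N) (\<lambda>_ _ x. x) (\<lambda>_ x. x)"
      using A_split by (simp add: direct_system_morphism_def split_mono_def)
    show "(\<lambda>x. x) \<in> rmod_hom R P N" using P_sub by (simp add: is_submodule_def)
  qed (simp_all add: A_add N_add A_split)
  then have pure: "strongly_pure_submodule R \<C> P N"
    using P_sub by (simp add: strongly_pure_submodule_def)
  have memP: "x \<in> carrier P \<longleftrightarrow> x \<in> carrier N \<and> (\<exists>n. \<pi> n x = x)" for x
    by (simp add: P_def S_def)
  \<comment> \<open>A positive index is wanted so that the recursion for \<open>\<pi>\<close> can be
    unfolded; raising the index is harmless.\<close>
  have ex_Suc: "\<exists>n. \<pi> (Suc n) x = x" if "x \<in> carrier P" for x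
    using that fix_mono memP le_SucI by blast
  have p_fix: "\<exists>n. \<pi> n (p x) = p x" and dec: "k x \<oplus>\<^bsub>N\<^esub> u (p x) = x" if x: "x \<in> carrier P" for x
  proof -
    have xN: "x \<in> carrier N" using x memP by simp
    obtain n where n: "\<pi> (Suc n) x = x" using ex_Suc[OF x] by blast
    have y: "\<pi> n (p x) \<in> carrier N" using xN pc \<pi>c by simp
    \<comment> \<open>Applying \<open>p\<close> to \<open>x = k x + u (\<pi> n (p x))\<close> shows
      that \<open>p x\<close> lies one stage lower.\<close>
    have "p x = p (k x \<oplus>\<^bsub>N\<^esub> u (\<pi> n (p x)))" using n by (simp add: \<pi>Suc)
    also have "\<dots> = \<pi> n (p x)" using xN y by (simp add: rmod_hom_add[OF p] kc uc pk pu)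
    finally have px: "\<pi> n (p x) = p x" by simp
    then show "\<exists>n. \<pi> n (p x) = p x" by blast
    show "k x \<oplus>\<^bsub>N\<^esub> u (p x) = x" using n px by (simp add: \<pi>Suc)
  qed
  show thesis
  proof (rule that[OF PR pure])
    fix x assume x: "x \<in> carrier N"
    have "\<pi> (Suc 0) (k x) = k x"
      using x by (simp add: \<pi>Suc \<pi>0 kk kc rmod_hom_zero[OF u N N])
    then show "k x \<in> carrier P" using memP kc[OF x] by blast
  next
    fix x assume "x \<in> carrier P"
    then obtain n where x: "x \<in> carrier N" and n: "\<pi> n x = x" using memP by blast
    \<comment> \<open>Applying \<open>u\<close> moves an element one stage up, because
      \<open>k u = 0\<close> and \<open>p u = 1\<close>.\<close>
    have "\<pi> (Suc n) (u x) = u x" using x n by (simp add: \<pi>Suc ku pu uc)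
    then show "u x \<in> carrier P" using memP uc[OF x] by blast
  next
    fix x assume "x \<in> carrier P"
    then show "p x \<in> carrier P" using memP p_fix pc by blast
  qed (rule dec)
qed


section \<open>Mutually strongly pure modules\<close>

text \<open>Purity in both directions gives maps \<open>j\<close>, \<open>r\<close>,
  \<open>t\<close> between the envelopes. Their composites \<open>j r\<close> and \<open>t r\<close>
  are endomorphisms of \<open>XN\<close>, so invariance of \<open>N\<close> restricts them to
  \<open>e\<close> and \<open>p\<close>. That \<open>e\<close> lands in \<open>M\<close> uses
  invariance of \<open>M\<close>: it equals \<open>f u\<close>, where \<open>f\<close> restricts
  \<open>r t\<close>.\<close>

lemma mutually_strongly_pure_split:
  assumes M_inv: "endomorphism_invariant R \<C> M XM vM"
    and N_inv: "endomorphism_invariant R \<C> N XN vN"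
    and XM: "right_module R XM" and XN: "right_module R XN"
    and MN: "strongly_pure_submodule R \<C> M N" and u: "strongly_pure_mono R \<C> N M u"
  obtains e p where "e \<in> rmod_hom R N N" "p \<in> rmod_hom R N N"
    "\<And>x. x \<in> carrier N \<Longrightarrow> e x \<in> carrier M" "\<And>x. x \<in> carrier M \<Longrightarrow> e x = x"
    "\<And>x. x \<in> carrier N \<Longrightarrow> p (u x) = x"
proof -
  have MsubN: "carrier M \<subseteq> carrier N" and i: "strongly_pure_mono R \<C> M N (\<lambda>x. x)"
    using MN by (simp_all add: strongly_pure_submodule_def is_submodule_def)
  have envM: "envelope R \<C> M XM vM" and envN: "envelope R \<C> N XN vN"
    and inj: "inj_on vN (carrier N)"
    using M_inv N_inv by (simp_all add: endomorphism_invariant_def mono_envelope_def)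
  have liftM: "\<And>f. f \<in> rmod_hom R XM XM \<Longrightarrow>
      \<exists>g\<in>rmod_hom R M M. \<forall>x\<in>carrier M. vM (g x) = f (vM x)"
    and liftN: "\<And>f. f \<in> rmod_hom R XN XN \<Longrightarrow>
      \<exists>g\<in>rmod_hom R N N. \<forall>x\<in>carrier N. vN (g x) = f (vN x)"
    using M_inv N_inv by (simp_all add: endomorphism_invariant_def)
  note vM = preenvelope_hom[OF envelope_preenvelope[OF envM]]
    and vN = preenvelope_hom[OF envelope_preenvelope[OF envN]]
    and uNM = strongly_pure_mono_hom[OF u]
  obtain j r where j: "j \<in> rmod_hom R XM XN" and r: "r \<in> rmod_hom R XN XM"
    and jv: "\<And>x. x \<in> carrier M \<Longrightarrow> j (vM x) = vN x"
    and rv: "\<And>x. x \<in> carrier M \<Longrightarrow> r (vN x) = vM x"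
    by (rule strongly_pure_mono_split_envelope[OF envM envelope_preenvelope[OF envN] i XM]) blast
  obtain s t where t: "t \<in> rmod_hom R XM XN"
    and tv: "\<And>x. x \<in> carrier N \<Longrightarrow> t (vM (u x)) = vN x"
    by (rule strongly_pure_mono_split_envelope[OF envN envelope_preenvelope[OF envM] u XN]) blast
  obtain p where p: "p \<in> rmod_hom R N N" and vp: "\<And>x. x \<in> carrier N \<Longrightarrow> vN (p x) = t (r (vN x))"
    using liftN[OF rmod_hom_compose[OF t r]] by blast
  obtain e where e: "e \<in> rmod_hom R N N" and ve: "\<And>x. x \<in> carrier N \<Longrightarrow> vN (e x) = j (r (vN x))"
    using liftN[OF rmod_hom_compose[OF j r]] by blast
  obtain f where f: "f \<in> rmod_hom R M M" and vf: "\<And>x. x \<in> carrier M \<Longrightarrow> vM (f x) = r (t (vM x))"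
    using liftM[OF rmod_hom_compose[OF r t]] by blast
  note uc = rmod_hom_closed[OF uNM] and ec = rmod_hom_closed[OF e] and pc = rmod_hom_closed[OF p]
    and fc = rmod_hom_closed[OF f]
  have v_eq: "x = y" if "vN x = vN y" "x \<in> carrier N" "y \<in> carrier N" for x y
    using that inj by (auto dest: inj_onD)
  have pu: "p (u x) = x" if x: "x \<in> carrier N" for x
  proof (rule v_eq)
    have "u x \<in> carrier N" using uc[OF x] MsubN by blast
    then show "vN (p (u x)) = vN x" "p (u x) \<in> carrier N"
      using vp rv[OF uc[OF x]] tv[OF x] pc by simp_all
  qed (rule x)
  have eM: "e x = x" if x: "x \<in> carrier M" for x
    using x MsubN ec by (intro v_eq) (auto simp: ve rv jv)
  have "e x \<in> carrier M" if x: "x \<in> carrier N" for x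
  proof -
    have m: "u x \<in> carrier M" by (rule uc[OF x])
    \<comment> \<open>Writing \<open>vN x\<close> as \<open>t (vM (u x))\<close> exposes the
      endomorphism \<open>r t\<close> of \<open>XM\<close>, which \<open>f\<close> realises on
      \<open>M\<close>.\<close>
    have "vN (e x) = j (r (t (vM (u x))))" using ve[OF x] tv[OF x] by simp
    also have "\<dots> = vN (f (u x))" using vf[OF m] jv[OF fc[OF m]] by simp
    finally have "e x = f (u x)" using v_eq ec[OF x] fc[OF m] MsubN by blast
    then show ?thesis using fc[OF m] by simp
  qed
  then show thesis using that[OF e p] eM pu by blast
qed

section \<open>The isomorphism between \<open>N\<close> and \<open>M\<close>\<close>

theorem theorem2p7:
  fixes R :: "('r, 'a) ring_scheme"
    and \<C> :: "('r, 'm) module set"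
    and M N XM XN :: "('r, 'm) module"
    and vM vN u :: "'m \<Rightarrow> 'm"
  assumes "ring R"
    and "enveloping_class R \<C>"
    and "\<forall>K\<in>(right_modules R :: ('r, 'm) module set). \<exists>X v. mono_envelope R \<C> K X v"
    and "M \<in> right_modules R" and "N \<in> right_modules R"
    and "mono_envelope R \<C> M XM vM" and "mono_envelope R \<C> N XN vN"
    and "endomorphism_invariant R \<C> M XM vM" and "endomorphism_invariant R \<C> N XN vN"
    and "strongly_purely_closed R \<C> N"
    and "strongly_pure_submodule R \<C> M N"
    and "strongly_pure_mono R \<C> N M u"
  shows "rmod_isomorphic R M N"
proof -
  have CR: "\<C> \<subseteq> right_modules R" using assms(2) by (simp add: enveloping_class_def)
  have N: "right_module R N" using assms(5) by (simp add: right_modules_def)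
  interpret N: right_module R N by fact
  have rmC: "right_module R X" if "X \<in> \<C>" for X
    using CR that by (auto simp: right_modules_def)
  have mem: "X \<in> \<C>" if "envelope R \<C> K X v" for K X :: "('r, 'm) module" and v
    using preenvelope_mem[OF envelope_preenvelope[OF that]] .
  have XM: "right_module R XM" and XN: "right_module R XN"
    using assms(6,7) unfolding mono_envelope_def by (blast intro: rmC mem)+
  have MN: "(\<lambda>x. x) \<in> rmod_hom R M N" and MsubN: "carrier M \<subseteq> carrier N" and M: "right_module R M"
    using assms(11) by (simp_all add: strongly_pure_submodule_def is_submodule_def)
  note uNM = strongly_pure_mono_hom[OF assms(12)]
  \<comment> \<open>Followed by the inclusion of \<open>M\<close>, the map \<open>u\<close> becomes
    an endomorphism of \<open>N\<close> and can be iterated.\<close>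
  have u: "u \<in> rmod_hom R N N" by (rule rmod_hom_compose[OF MN uNM])
  obtain e p\<^sub>0 where e: "e \<in> rmod_hom R N N" and p\<^sub>0: "p\<^sub>0 \<in> rmod_hom R N N"
    and e_in: "\<And>x. x \<in> carrier N \<Longrightarrow> e x \<in> carrier M" and e_id: "\<And>x. x \<in> carrier M \<Longrightarrow> e x = x"
    and p\<^sub>0u: "\<And>x. x \<in> carrier N \<Longrightarrow> p\<^sub>0 (u x) = x"
    by (rule mutually_strongly_pure_split[OF assms(8,9) XM XN assms(11,12)]) blast
  note ec = rmod_hom_closed[OF e] and uc = rmod_hom_closed[OF u]
  have eu: "e (u x) = u x" if "x \<in> carrier N" for x
    by (rule e_id[OF rmod_hom_closed[OF uNM that]])
  have ee: "e (e x) = e x" if "x \<in> carrier N" for x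
    by (rule e_id[OF e_in[OF that]])
  show ?thesis
  proof (cases "finite (carrier N)")
    case True
    have "inj_on u (carrier N)" by (rule inj_on_inverseI[of _ p\<^sub>0]) (rule p\<^sub>0u)
    then have "card (carrier N) \<le> card (carrier M)"
      using True MsubN rmod_hom_closed[OF uNM] finite_subset by (blast intro: card_inj_on_le)
    then have "carrier M = carrier N"
      using True MsubN by (simp add: card_seteq)
    then have "(\<lambda>x. x) \<in> rmod_iso R M N"
      using MN by (simp add: rmod_iso_def bij_betw_def)
    then show ?thesis by (auto simp: rmod_isomorphic_def)
  next
    case False
    define k where "k x = x \<ominus>\<^bsub>N\<^esub> e x" for x
    \<comment> \<open>Precomposing with \<open>e\<close> makes the retraction vanish on the
      complement \<open>k N\<close>; it remains a retraction of \<open>u\<close> because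
      \<open>e u = u\<close>.\<close>
    define p where "p x = p\<^sub>0 (e x)" for x
    have k: "k \<in> rmod_hom R N N"
      using rmod_hom_diff[OF N rmod_hom_id e] unfolding k_def .
    have p: "p \<in> rmod_hom R N N"
      using rmod_hom_compose[OF p\<^sub>0 e] unfolding p_def .
    note kc = rmod_hom_closed[OF k] and pc = rmod_hom_closed[OF p]
    have ek: "e (k x) = \<zero>\<^bsub>N\<^esub>" if "x \<in> carrier N" for x
      using that ec by (simp add: k_def rmod_hom_minus[OF e N N] ee N.M.minus_eq_zero_iff)
    have kk: "k (k x) = k x" if "x \<in> carrier N" for x
      using that kc[OF that] ek[OF that] by (simp add: k_def[of "k x"] a_minus_def)
    have ku: "k (u x) = \<zero>\<^bsub>N\<^esub>" if "x \<in> carrier N" for x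
      using that uc by (simp add: k_def eu N.M.minus_eq_zero_iff)
    have pk: "p (k x) = \<zero>\<^bsub>N\<^esub>" if "x \<in> carrier N" for x
      using ek[OF that] by (simp add: p_def rmod_hom_zero[OF p\<^sub>0 N N])
    have pu: "p (u x) = x" if "x \<in> carrier N" for x
      using that by (simp add: p_def eu p\<^sub>0u)
    obtain P where PR: "P \<in> right_modules R" and P: "strongly_pure_submodule R \<C> P N"
      and kP: "\<And>x. x \<in> carrier N \<Longrightarrow> k x \<in> carrier P"
      and uP: "\<And>x. x \<in> carrier P \<Longrightarrow> u x \<in> carrier P"
      and pP: "\<And>x. x \<in> carrier P \<Longrightarrow> p x \<in> carrier P"
      and dec: "\<And>x. x \<in> carrier P \<Longrightarrow> k x \<oplus>\<^bsub>N\<^esub> u (p x) = x"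
      by (rule strongly_pure_orbit[OF assms(5,10) False k u p kk ku pk pu])
        (assumption | (rule that; blast))+
    have PN: "x \<in> carrier N" if "x \<in> carrier P" for x
      using P that by (auto simp: strongly_pure_submodule_def is_submodule_def)
    obtain Y w where Y: "envelope R \<C> P Y w"
      using assms(3) PR unfolding mono_envelope_def by blast
    obtain q where q: "q \<in> rmod_hom R N N" and qP: "\<And>x. x \<in> carrier P \<Longrightarrow> q x = x"
      and qq: "\<And>x. x \<in> carrier N \<Longrightarrow> q (q x) = q x"
      and bij_all: "\<forall>h\<in>rmod_hom R N N. (\<forall>x\<in>carrier P. h x = x) \<longrightarrow>
        (\<forall>x\<in>carrier N. h x \<ominus>\<^bsub>N\<^esub> q (h x) = x \<ominus>\<^bsub>N\<^esub> q x) \<longrightarrow> bij_betw h (carrier N) (carrier N)"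
      by (rule strongly_pure_submodule_hull[OF assms(9) P Y XN rmC[OF mem[OF Y]]]) blast
    have bij: "bij_betw h (carrier N) (carrier N)"
      if "h \<in> rmod_hom R N N" "\<And>x. x \<in> carrier P \<Longrightarrow> h x = x"
        "\<And>x. x \<in> carrier N \<Longrightarrow> h x \<ominus>\<^bsub>N\<^esub> q (h x) = x \<ominus>\<^bsub>N\<^esub> q x" for h
      using bij_all that by blast
    note qc = rmod_hom_closed[OF q]
    \<comment> \<open>\<open>D\<close> is \<open>1 - q\<close>, so equality after \<open>D\<close>
      is congruence modulo \<open>q N\<close>. On \<open>P\<close> the maps \<open>U\<close> and
      \<open>V\<close> act as \<open>u\<close> and \<open>p\<close>, while modulo \<open>q N\<close>
      both are the identity.\<close>
    define D where "D x = x \<ominus>\<^bsub>N\<^esub> q x" for x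
    define U where "U x = D x \<oplus>\<^bsub>N\<^esub> q (u x)" for x
    define V where "V x = D x \<oplus>\<^bsub>N\<^esub> q (p x)" for x
    have D: "D \<in> rmod_hom R N N"
      using rmod_hom_diff[OF N rmod_hom_id q] unfolding D_def .
    have U: "U \<in> rmod_hom R N N"
      using rmod_hom_sum[OF N D rmod_hom_compose[OF q u]] unfolding U_def .
    have V: "V \<in> rmod_hom R N N"
      using rmod_hom_sum[OF N D rmod_hom_compose[OF q p]] unfolding V_def .
    note Dc = rmod_hom_closed[OF D] and Uc = rmod_hom_closed[OF U] and Vc = rmod_hom_closed[OF V]
    have DP: "D x = \<zero>\<^bsub>N\<^esub>" if "x \<in> carrier P" for x
      using that PN by (simp add: D_def qP N.M.minus_eq_zero_iff)
    have Dq: "D (q x) = \<zero>\<^bsub>N\<^esub>" if "x \<in> carrier N" for x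
      using that qc by (simp add: D_def qq N.M.minus_eq_zero_iff)
    have qD: "q (D x) = \<zero>\<^bsub>N\<^esub>" if "x \<in> carrier N" for x
      using that qc by (simp add: D_def rmod_hom_minus[OF q N N] qq N.M.minus_eq_zero_iff)
    have DD: "D (D x) = D x" if "x \<in> carrier N" for x
      using that Dc[OF that] qD[OF that] by (simp add: D_def[of "D x"] a_minus_def)
    \<comment> \<open>The difference \<open>x - e x = k x\<close> lies in \<open>P\<close>, which
      \<open>D\<close> kills; so \<open>e\<close> too is the identity modulo
      \<open>q N\<close>.\<close>
    have De: "D (e x) = D x" if x: "x \<in> carrier N" for x
    proof -
      have "D x \<ominus>\<^bsub>N\<^esub> D (e x) = \<zero>\<^bsub>N\<^esub>"
        using rmod_hom_minus[OF D N N x ec[OF x]] DP[OF kP[OF x]] by (simp add: k_def)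
      then show ?thesis
        by (simp only: N.M.minus_eq_zero_iff[OF Dc[OF x] Dc[OF ec[OF x]]])
    qed
    have DU: "D (U x) = D x" if "x \<in> carrier N" for x
      using that by (simp add: U_def rmod_hom_add[OF D] DD Dq Dc qc uc)
    have DV: "D (V x) = D x" if "x \<in> carrier N" for x
      using that by (simp add: V_def rmod_hom_add[OF D] DD Dq Dc qc pc)
    have UP: "U x = u x" if "x \<in> carrier P" for x
      using that by (simp add: U_def DP qP uP uc PN)
    have VP: "V x = p x" if "x \<in> carrier P" for x
      using that by (simp add: V_def DP qP pP pc PN)
    let ?F = "\<lambda>x. e (U x)"
    have F: "?F \<in> rmod_hom R N N" by (rule rmod_hom_compose[OF e U])
    \<comment> \<open>\<open>V e U\<close> meets the bijectivity criterion: on \<open>P\<close> it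
      is \<open>p e u = p u = 1\<close>, and modulo \<open>q N\<close> each factor is the identity.
      Hence its inner part \<open>e U\<close> is injective.\<close>
    have F_inj: "inj_on ?F (carrier N)"
    proof -
      have "bij_betw (\<lambda>x. V (?F x)) (carrier N) (carrier N)"
      proof (rule bij[OF rmod_hom_compose[OF V F]])
        show "V (?F x) = x" if "x \<in> carrier P" for x
          using that by (simp add: UP eu PN VP uP pu)
        show "V (?F x) \<ominus>\<^bsub>N\<^esub> q (V (?F x)) = x \<ominus>\<^bsub>N\<^esub> q x" if "x \<in> carrier N" for x
          using that DV[of "?F x"] by (simp add: De DU ec Uc flip: D_def)
      qed
      then have "inj_on (V \<circ> ?F) (carrier N)" by (simp add: bij_betw_def comp_def)
      then show ?thesis by (rule inj_on_imageI2)
    qed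
    \<comment> \<open>On \<open>P\<close> this is \<open>u p + k = 1\<close> by \<open>dec\<close>.
      Modulo \<open>q N\<close> the summand \<open>k x\<close> vanishes and the rest is the
      identity, so the criterion applies again.\<close>
    let ?W = "\<lambda>x. ?F (V x) \<oplus>\<^bsub>N\<^esub> k x"
    have W: "bij_betw ?W (carrier N) (carrier N)"
    proof (rule bij[OF rmod_hom_sum[OF N rmod_hom_compose[OF F V] k]])
      fix x assume x: "x \<in> carrier P"
      then have "?F (V x) = u (p x)" by (simp add: VP UP pP PN eu)
      moreover have "u (p x) \<oplus>\<^bsub>N\<^esub> k x = k x \<oplus>\<^bsub>N\<^esub> u (p x)"
        by (rule N.M.a_comm) (simp_all add: x PN kc uc pc)
      ultimately show "?W x = x" using dec[OF x] by simp
    next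
      fix x assume x: "x \<in> carrier N"
      then have "D (?W x) = D x"
        by (simp add: rmod_hom_add[OF D] De DU DV DP kP ec Uc Vc kc Dc)
      then show "?W x \<ominus>\<^bsub>N\<^esub> q (?W x) = x \<ominus>\<^bsub>N\<^esub> q x" unfolding D_def .
    qed
    have "carrier M \<subseteq> ?F ` carrier N"
    proof
      fix m assume m: "m \<in> carrier M"
      then have "m \<in> ?W ` carrier N" using MsubN bij_betw_imp_surj_on[OF W] by auto
      then obtain x where x: "x \<in> carrier N" and Wx: "m = ?W x" by (rule imageE)
      \<comment> \<open>Applying \<open>e\<close> fixes \<open>m\<close>, removes the summand
        \<open>k x\<close>, and leaves \<open>?F (V x)\<close> unchanged, so \<open>m\<close> is a
        value of \<open>?F\<close>.\<close>
      have "m = e (?W x)" using e_id[OF m] by (simp only: Wx)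
      also have "\<dots> = ?F (V x)"
        using x by (simp add: rmod_hom_add[OF e] ee ek ec Uc Vc kc)
      finally show "m \<in> ?F ` carrier N" using Vc[OF x] by blast
    qed
    then have F_bij: "bij_betw ?F (carrier N) (carrier M)"
      using F_inj e_in Uc by (auto simp: bij_betw_def)
    \<comment> \<open>The operations of \<open>M\<close> are restricted from \<open>N\<close>, so
      linearity into \<open>N\<close> transfers to the smaller codomain.\<close>
    have "?F \<in> rmod_hom R N M"
    proof (rule rmod_homI)
      fix x y assume "x \<in> carrier N" "y \<in> carrier N"
      then show "?F (x \<oplus>\<^bsub>N\<^esub> y) = ?F x \<oplus>\<^bsub>M\<^esub> ?F y"
        using rmod_hom_add[OF F] rmod_hom_add[OF MN] e_in Uc by simp
    next
      fix a x assume "a \<in> carrier R" "x \<in> carrier N"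
      then show "?F (a \<odot>\<^bsub>N\<^esub> x) = a \<odot>\<^bsub>M\<^esub> ?F x"
        using rmod_hom_smult[OF F] rmod_hom_smult[OF MN] e_in Uc by simp
    qed (use e_in Uc in simp)
    then have "?F \<in> rmod_iso R N M" using F_bij by (simp add: rmod_iso_def)
    from rmod_iso_inv[OF this N] show ?thesis by (auto simp: rmod_isomorphic_def)
  qed
qed

end
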